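(* Let $(M,E)$ be a Finsler manifold and let $L$ be a semibasic vector $1$-form on $TM$. Then the $L$-Ehresmann connection $\mathbf{h}_L=\mathbf{h}_0+L+[J,(d_LE)^{\#}]$ is conservative (i.e. $d_{\mathbf{h}_L}E=0$) if and only if the function $L^\circ E$ is a vertical lift.
   Context: $M$ is a connected smooth $n$-dimensional manifold (Hausdorff, countable base), $\pi:TM\to M$ its tangent bundle, $\overset{\circ}{T}M\subset TM$ the open submanifold of nonzero tangent vectors. The vertical lift of a smooth function $f$ on $M$ is $f^v:=f\circ\pi$; a function on $TM$ is a vertical lift if it is of this form. $C$ is the Liouville vector field on $TM$ and $J$ is the vertical endomorphism of $TM$ (the $(1,1)$ tensor with image and kernel the vertical vector fields, $[J,J]=0$, $[J,C]=J$). A vector $1$-form is a $(1,1)$ tensor field. For a vector $1$-form $K$ and a function $\varphi$, $d_K\varphi:=d\varphi\circ K$. For a vector field $Y$, $[K,Y]$ is the vector $1$-form $[K,Y]X=[KX,Y]-K[X,Y]$. A vector $1$-form $L$ is semibasic if $L\circ J=0$ and $J\circ L=0$. A semispray over $M$ is a vector field $S$ on $TM$ of class $C^1$, smooth on $\overset{\circ}{T}M$, with $JS=C$. The potential of a semibasic vector $1$-form $L$ is the vector field $L^\circ:=L(S)$, $S$ any semispray (independent of the choice). $L^\circ E$ denotes the derivative of $E$ along $L^\circ$. A Finsler manifold $(M,E)$: $E:TM\to\mathbb{R}$ with $E(0)=0$, $E>0$ on $\overset{\circ}{T}M$, $E$ of class $C^1$ on $TM$ and smooth on $\overset{\circ}{T}M$,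 $E$ positively homogeneous of degree $2$ ($CE=2E$), and the fundamental $2$-form $\omega:=d\,d_JE$ (where $d_JE=dE\circ J$) nondegenerate. For a $1$-form $\beta$, $\beta^{\#}$ is the unique vector field (smooth in general only on $\overset{\circ}{T}M$) with $i_{\beta^{\#}}\omega=\beta$. An Ehresmann connection is a vector $1$-form $\mathbf{h}$ (smooth in general only on $\overset{\circ}{T}M$) with $\mathbf{h}^2=\mathbf{h}$ and $\ker\mathbf{h}$ the vertical vector fields; it is conservative with respect to $E$ if $d_{\mathbf{h}}E=0$. The canonical spray is $S_0:=-(dE)^{\#}$ over $\overset{\circ}{T}M$, $S_0(0):=0$, and the Berwald connection is $\mathbf{h}_0:=\frac12(\mathrm{id}+[J,S_0])$. *)

theory Defs
  imports "HOL-Analysis.Analysis"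
begin

section \<open>Smooth maps between Euclidean spaces\<close>

text \<open>Meant for open sets: all iterated directional derivatives up to order \<open>k\<close> exist and
  are continuous.\<close>

primrec Ck_on :: "nat \<Rightarrow> 'e::euclidean_space set \<Rightarrow> ('e \<Rightarrow> 'b::real_normed_vector) \<Rightarrow> bool" where
  "Ck_on 0 U f \<longleftrightarrow> continuous_on U f"
| "Ck_on (Suc k) U f \<longleftrightarrow> (\<forall>x\<in>U. f differentiable (at x)) \<and>
     (\<forall>v. Ck_on k U (\<lambda>x. frechet_derivative f (at x) v))"

definition smooth_on :: "'e::euclidean_space set \<Rightarrow> ('e \<Rightarrow> 'b::real_normed_vector) \<Rightarrow> bool" where
  "smooth_on U f \<longleftrightarrow> (\<forall>k. Ck_on k U f)"

section \<open>Smooth manifolds\<close>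

datatype ('a, 'e) chart = Chart (cdom: "'a set") (cmap: "'a \<Rightarrow> 'e")

definition cinv :: "('a, 'e) chart \<Rightarrow> 'e \<Rightarrow> 'a" where
  "cinv c = inv_into (cdom c) (cmap c)"

definition smooth_atlas :: "('a, 'e::euclidean_space) chart set \<Rightarrow> bool" where
  "smooth_atlas A \<longleftrightarrow>
     (\<forall>c\<in>A. inj_on (cmap c) (cdom c) \<and> open (cmap c ` cdom c)) \<and>
     (\<forall>c\<in>A. \<forall>d\<in>A. open (cmap c ` (cdom c \<inter> cdom d)) \<and>
        smooth_on (cmap c ` (cdom c \<inter> cdom d)) (cmap d \<circ> cinv c))"

definition points :: "('a, 'e) chart set \<Rightarrow> 'a set" where
  "points A = (\<Union>c\<in>A. cdom c)"

text \<open>The topology for which all charts of the atlas are homeomorphisms onto open sets.\<close>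

definition manifold_topology :: "('a, 'e::euclidean_space) chart set \<Rightarrow> 'a topology" where
  "manifold_topology A =
     topology (\<lambda>V. V \<subseteq> points A \<and> (\<forall>c\<in>A. open (cmap c ` (V \<inter> cdom c))))"

text \<open>The dimension is \<open>DIM('e)\<close>.\<close>

definition smooth_manifold :: "('a, 'e::euclidean_space) chart set \<Rightarrow> bool" where
  "smooth_manifold A \<longleftrightarrow> smooth_atlas A \<and>
     Hausdorff_space (manifold_topology A) \<and> second_countable (manifold_topology A)"

definition charts_at :: "('a, 'e) chart set \<Rightarrow> 'a \<Rightarrow> ('a, 'e) chart set" where
  "charts_at A p = {c \<in> A. p \<in> cdom c}"

definition chart_at :: "('a, 'e) chart set \<Rightarrow> 'a \<Rightarrow> ('a, 'e) chart" where
  "chart_at A p = (SOME c. c \<in> charts_at A p)"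

definition Ck_fun :: "('a, 'e::euclidean_space) chart set \<Rightarrow> nat \<Rightarrow> 'a set
    \<Rightarrow> ('a \<Rightarrow> 'b::real_normed_vector) \<Rightarrow> bool" where
  "Ck_fun A k W f \<longleftrightarrow> (\<forall>c\<in>A. Ck_on k (cmap c ` (W \<inter> cdom c)) (f \<circ> cinv c))"

definition smooth_fun :: "('a, 'e::euclidean_space) chart set \<Rightarrow> 'a set
    \<Rightarrow> ('a \<Rightarrow> 'b::real_normed_vector) \<Rightarrow> bool" where
  "smooth_fun A W f \<longleftrightarrow> (\<forall>k. Ck_fun A k W f)"

section \<open>Tangent vectors and the tangent bundle\<close>

text \<open>A tangent vector at \<open>p\<close> is the family of its component vectors in all charts around \<open>p\<close>,
  subject to the contravariant transformation law. The family is extended by \<open>0\<close> to the other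
  charts, so that equality of tangent vectors is equality in HOL.\<close>

datatype ('a, 'e) tvec = TVec (base: 'a) (comp: "('a, 'e) chart \<Rightarrow> 'e")

definition tvec_at :: "('a, 'e::euclidean_space) chart set \<Rightarrow> 'a \<Rightarrow> (('a, 'e) chart \<Rightarrow> 'e)
    \<Rightarrow> ('a, 'e) tvec" where
  "tvec_at A p u = TVec p (\<lambda>c. if c \<in> charts_at A p then u c else 0)"

definition tangent_space :: "('a, 'e::euclidean_space) chart set \<Rightarrow> 'a \<Rightarrow> ('a, 'e) tvec set" where
  "tangent_space A p = {\<xi>. base \<xi> = p \<and>
     (\<forall>c. c \<notin> charts_at A p \<longrightarrow> comp \<xi> c = 0) \<and>
     (\<forall>c\<in>charts_at A p. \<forall>d\<in>charts_at A p.
        comp \<xi> d = frechet_derivative (cmap d \<circ> cinv c) (at (cmap c p)) (comp \<xi> c))}"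

definition tadd :: "('a, 'e::euclidean_space) tvec \<Rightarrow> ('a, 'e) tvec \<Rightarrow> ('a, 'e) tvec" where
  "tadd \<xi> \<eta> = TVec (base \<xi>) (\<lambda>c. comp \<xi> c + comp \<eta> c)"

definition tscale :: "real \<Rightarrow> ('a, 'e::euclidean_space) tvec \<Rightarrow> ('a, 'e) tvec" where
  "tscale r \<xi> = TVec (base \<xi>) (\<lambda>c. r *\<^sub>R comp \<xi> c)"

definition tzero :: "'a \<Rightarrow> ('a, 'e::euclidean_space) tvec" where
  "tzero p = TVec p (\<lambda>c. 0)"

abbreviation tdiff :: "('a, 'e::euclidean_space) tvec \<Rightarrow> ('a, 'e) tvec \<Rightarrow> ('a, 'e) tvec" where
  "tdiff \<xi> \<eta> \<equiv> tadd \<xi> (tscale (- 1) \<eta>)"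

definition tangent_bundle :: "('a, 'e::euclidean_space) chart set \<Rightarrow> ('a, 'e) tvec set" where
  "tangent_bundle A = (\<Union>p\<in>points A. tangent_space A p)"

definition nonzero_tangent :: "('a, 'e::euclidean_space) chart set \<Rightarrow> ('a, 'e) tvec set" where
  "nonzero_tangent A = {v \<in> tangent_bundle A. v \<noteq> tzero (base v)}"

text \<open>The induced charts \<open>(x, y)\<close> of the tangent bundle. They make it a smooth manifold in the
  sense above, so that everything below also applies to the tangent bundle in place of the
  manifold; the bundle projection is \<^const>\<open>base\<close>.\<close>

definition tangent_atlas :: "('a, 'e::euclidean_space) chart set
    \<Rightarrow> (('a, 'e) tvec, 'e \<times> 'e) chart set" where
  "tangent_atlas A =
     (\<lambda>c. Chart {v \<in> tangent_bundle A. base v \<in> cdom c} (\<lambda>v. (cmap c (base v), comp v c))) ` A"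

section \<open>Calculus on a manifold\<close>

definition dfun :: "('a, 'e::euclidean_space) chart set \<Rightarrow> ('a \<Rightarrow> 'b::real_normed_vector)
    \<Rightarrow> ('a, 'e) tvec \<Rightarrow> 'b" where
  "dfun A f \<xi> = (let c = chart_at A (base \<xi>) in
     frechet_derivative (f \<circ> cinv c) (at (cmap c (base \<xi>))) (comp \<xi> c))"

definition tangent_map :: "('a, 'e::euclidean_space) chart set \<Rightarrow> ('b, 'f::euclidean_space) chart set
    \<Rightarrow> ('a \<Rightarrow> 'b) \<Rightarrow> ('a, 'e) tvec \<Rightarrow> ('b, 'f) tvec" where
  "tangent_map A B f \<xi> = tvec_at B (f (base \<xi>)) (\<lambda>d. dfun A (cmap d \<circ> f) \<xi>)"

definition velocity :: "('a, 'e::euclidean_space) chart set \<Rightarrow> (real \<Rightarrow> 'a) \<Rightarrow> ('a, 'e) tvec" where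
  "velocity A \<gamma> = tvec_at A (\<gamma> 0) (\<lambda>c. vector_derivative (cmap c \<circ> \<gamma>) (at 0))"

type_synonym ('a, 'e) vfield = "'a \<Rightarrow> ('a, 'e) tvec"

definition vfcomp :: "('a, 'e) chart \<Rightarrow> ('a, 'e) vfield \<Rightarrow> 'e \<Rightarrow> 'e" where
  "vfcomp c X x = comp (X (cinv c x)) c"

definition Ck_vfield :: "('a, 'e::euclidean_space) chart set \<Rightarrow> nat \<Rightarrow> 'a set
    \<Rightarrow> ('a, 'e) vfield \<Rightarrow> bool" where
  "Ck_vfield A k W X \<longleftrightarrow> (\<forall>p\<in>W. X p \<in> tangent_space A p) \<and>
     (\<forall>c\<in>A. Ck_on k (cmap c ` (W \<inter> cdom c)) (vfcomp c X))"

definition smooth_vfield :: "('a, 'e::euclidean_space) chart set \<Rightarrow> 'a set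
    \<Rightarrow> ('a, 'e) vfield \<Rightarrow> bool" where
  "smooth_vfield A W X \<longleftrightarrow> (\<forall>k. Ck_vfield A k W X)"

definition lie_bracket :: "('a, 'e::euclidean_space) chart set \<Rightarrow> ('a, 'e) vfield
    \<Rightarrow> ('a, 'e) vfield \<Rightarrow> ('a, 'e) vfield" where
  "lie_bracket A X Y p = tvec_at A p (\<lambda>c.
     frechet_derivative (vfcomp c Y) (at (cmap c p)) (vfcomp c X (cmap c p)) -
     frechet_derivative (vfcomp c X) (at (cmap c p)) (vfcomp c Y (cmap c p)))"

text \<open>A smooth vector field, defined near the base point of \<open>\<xi>\<close>, with value \<open>\<xi>\<close> there. It is
  used below to evaluate at tangent vectors expressions which are given on vector fields but are
  tensorial, so that the choice of the extension is immaterial.\<close>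

definition extension :: "('a, 'e::euclidean_space) chart set \<Rightarrow> ('a, 'e) tvec
    \<Rightarrow> ('a, 'e) vfield" where
  "extension A \<xi> = (SOME X. \<exists>V. openin (manifold_topology A) V \<and> base \<xi> \<in> V \<and>
     smooth_vfield A V X \<and> X (base \<xi>) = \<xi>)"

text \<open>One-forms and vector one-forms are represented by functions on tangent vectors.\<close>

type_synonym ('a, 'e) form1 = "('a, 'e) tvec \<Rightarrow> real"
type_synonym ('a, 'e) form2 = "('a, 'e) tvec \<Rightarrow> ('a, 'e) tvec \<Rightarrow> real"
type_synonym ('a, 'e) vform = "('a, 'e) tvec \<Rightarrow> ('a, 'e) tvec"

text \<open>\<open>d\<beta>(X,Y) = X(\<beta>(Y)) - Y(\<beta>(X)) - \<beta>([X,Y])\<close>\<close>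

definition ext_deriv :: "('a, 'e::euclidean_space) chart set \<Rightarrow> ('a, 'e) form1
    \<Rightarrow> ('a, 'e) form2" where
  "ext_deriv A \<beta> \<xi> \<eta> = (let X = extension A \<xi>; Y = extension A \<eta> in
     dfun A (\<lambda>q. \<beta> (Y q)) \<xi> - dfun A (\<lambda>q. \<beta> (X q)) \<eta> - \<beta> (lie_bracket A X Y (base \<xi>)))"

definition smooth_vform :: "('a, 'e::euclidean_space) chart set \<Rightarrow> 'a set
    \<Rightarrow> ('a, 'e) vform \<Rightarrow> bool" where
  "smooth_vform A W K \<longleftrightarrow>
     (\<forall>p\<in>W. \<forall>\<xi>\<in>tangent_space A p. K \<xi> \<in> tangent_space A p \<and>
        (\<forall>r. K (tscale r \<xi>) = tscale r (K \<xi>)) \<and>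
        (\<forall>\<eta>\<in>tangent_space A p. K (tadd \<xi> \<eta>) = tadd (K \<xi>) (K \<eta>))) \<and>
     (\<forall>V X. openin (manifold_topology A) V \<and> V \<subseteq> W \<and> smooth_vfield A V X \<longrightarrow>
        smooth_vfield A V (\<lambda>p. K (X p)))"

text \<open>\<open>d\<^sub>K f = df \<circ> K\<close>\<close>

definition d_along :: "('a, 'e::euclidean_space) chart set \<Rightarrow> ('a, 'e) vform \<Rightarrow> ('a \<Rightarrow> real)
    \<Rightarrow> ('a, 'e) form1" where
  "d_along A K f \<xi> = dfun A f (K \<xi>)"

text \<open>\<open>[K,Y]X = [KX,Y] - K[X,Y]\<close>\<close>

definition vform_bracket :: "('a, 'e::euclidean_space) chart set \<Rightarrow> ('a, 'e) vform
    \<Rightarrow> ('a, 'e) vfield \<Rightarrow> ('a, 'e) vform" where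
  "vform_bracket A K Y \<xi> = (let X = extension A \<xi> in
     tdiff (lie_bracket A (\<lambda>q. K (X q)) Y (base \<xi>)) (K (lie_bracket A X Y (base \<xi>))))"

definition nondegenerate_at :: "('a, 'e::euclidean_space) chart set \<Rightarrow> ('a, 'e) form2
    \<Rightarrow> 'a \<Rightarrow> bool" where
  "nondegenerate_at A \<omega> p \<longleftrightarrow> (\<forall>\<xi>\<in>tangent_space A p.
     (\<forall>\<eta>\<in>tangent_space A p. \<omega> \<xi> \<eta> = 0) \<longrightarrow> \<xi> = tzero p)"

definition sharp :: "('a, 'e::euclidean_space) chart set \<Rightarrow> ('a, 'e) form2
    \<Rightarrow> ('a, 'e) form1 \<Rightarrow> ('a, 'e) vfield" where
  "sharp A \<omega> \<beta> p = (THE \<xi>. \<xi> \<in> tangent_space A p \<and> (\<forall>\<eta>\<in>tangent_space A p. \<omega> \<xi> \<eta> = \<beta> \<eta>))"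

section \<open>Geometry of the tangent bundle\<close>

text \<open>In what follows \<open>A\<close> is an atlas of \<open>M\<close>; objects on \<open>TM\<close> refer to \<open>tangent_atlas A\<close>.\<close>

definition vlift :: "('a, 'e::euclidean_space) chart set \<Rightarrow> ('a, 'e) tvec \<Rightarrow> ('a, 'e) tvec
    \<Rightarrow> (('a, 'e) tvec, 'e \<times> 'e) tvec" where
  "vlift A v w = velocity (tangent_atlas A) (\<lambda>t. tadd v (tscale t w))"

definition liouville :: "('a, 'e::euclidean_space) chart set
    \<Rightarrow> (('a, 'e) tvec, 'e \<times> 'e) vfield" where
  "liouville A v = vlift A v v"

text \<open>The vertical endomorphism \<open>J\<close>. The properties \<open>Im J = Ker J = VTM\<close>, \<open>[J,J] = 0\<close>,
  \<open>[J,C] = J\<close> hold for it but do not single it out, hence the usual explicit description: the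
  vertical lift to \<open>v\<close> of the projection of \<open>\<xi> \<in> T\<^sub>v TM\<close>.\<close>

definition vertical_endo :: "('a, 'e::euclidean_space) chart set
    \<Rightarrow> (('a, 'e) tvec, 'e \<times> 'e) vform" where
  "vertical_endo A \<xi> = vlift A (base \<xi>) (tangent_map (tangent_atlas A) A base \<xi>)"

definition semibasic :: "('a, 'e::euclidean_space) chart set
    \<Rightarrow> (('a, 'e) tvec, 'e \<times> 'e) vform \<Rightarrow> bool" where
  "semibasic A L \<longleftrightarrow> (\<forall>v\<in>tangent_bundle A. \<forall>\<xi>\<in>tangent_space (tangent_atlas A) v.
     L (vertical_endo A \<xi>) = tzero v \<and> vertical_endo A (L \<xi>) = tzero v)"

definition semispray :: "('a, 'e::euclidean_space) chart set
    \<Rightarrow> (('a, 'e) tvec, 'e \<times> 'e) vfield \<Rightarrow> bool" where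
  "semispray A S \<longleftrightarrow> Ck_vfield (tangent_atlas A) 1 (tangent_bundle A) S \<and>
     smooth_vfield (tangent_atlas A) (nonzero_tangent A) S \<and>
     (\<forall>v\<in>tangent_bundle A. vertical_endo A (S v) = liouville A v)"

text \<open>The potential \<open>L\<^sup>\<circ>\<close> computed with the semispray \<open>S\<close>.\<close>

definition potential :: "(('a, 'e::euclidean_space) tvec, 'e \<times> 'e) vform
    \<Rightarrow> (('a, 'e) tvec, 'e \<times> 'e) vfield \<Rightarrow> (('a, 'e) tvec, 'e \<times> 'e) vfield" where
  "potential L S v = L (S v)"

definition is_vertical_lift :: "('a, 'e::euclidean_space) chart set
    \<Rightarrow> (('a, 'e) tvec \<Rightarrow> real) \<Rightarrow> bool" where
  "is_vertical_lift A F \<longleftrightarrow>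
     (\<exists>f. smooth_fun A (points A) f \<and> (\<forall>v\<in>tangent_bundle A. F v = f (base v)))"

section \<open>Finsler manifolds\<close>

definition fundamental_form :: "('a, 'e::euclidean_space) chart set \<Rightarrow> (('a, 'e) tvec \<Rightarrow> real)
    \<Rightarrow> (('a, 'e) tvec, 'e \<times> 'e) form2" where
  "fundamental_form A E =
     ext_deriv (tangent_atlas A) (d_along (tangent_atlas A) (vertical_endo A) E)"

definition finsler_energy :: "('a, 'e::euclidean_space) chart set \<Rightarrow> (('a, 'e) tvec \<Rightarrow> real)
    \<Rightarrow> bool" where
  "finsler_energy A E \<longleftrightarrow>
     (\<forall>p\<in>points A. E (tzero p) = 0) \<and>
     (\<forall>v\<in>nonzero_tangent A. E v > 0) \<and>
     Ck_fun (tangent_atlas A) 1 (tangent_bundle A) E \<and>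
     smooth_fun (tangent_atlas A) (nonzero_tangent A) E \<and>
     (\<forall>v\<in>tangent_bundle A. \<forall>r>0. E (tscale r v) = r\<^sup>2 * E v) \<and>
     (\<forall>v\<in>nonzero_tangent A. nondegenerate_at (tangent_atlas A) (fundamental_form A E) v)"

definition finsler_sharp :: "('a, 'e::euclidean_space) chart set \<Rightarrow> (('a, 'e) tvec \<Rightarrow> real)
    \<Rightarrow> (('a, 'e) tvec, 'e \<times> 'e) form1 \<Rightarrow> (('a, 'e) tvec, 'e \<times> 'e) vfield" where
  "finsler_sharp A E = sharp (tangent_atlas A) (fundamental_form A E)"

definition canonical_spray :: "('a, 'e::euclidean_space) chart set \<Rightarrow> (('a, 'e) tvec \<Rightarrow> real)
    \<Rightarrow> (('a, 'e) tvec, 'e \<times> 'e) vfield" where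
  "canonical_spray A E v = (if v \<in> nonzero_tangent A
     then tscale (- 1) (finsler_sharp A E (dfun (tangent_atlas A) E) v) else tzero v)"

definition berwald_connection :: "('a, 'e::euclidean_space) chart set \<Rightarrow> (('a, 'e) tvec \<Rightarrow> real)
    \<Rightarrow> (('a, 'e) tvec, 'e \<times> 'e) vform" where
  "berwald_connection A E \<xi> = tscale (1/2)
     (tadd \<xi> (vform_bracket (tangent_atlas A) (vertical_endo A) (canonical_spray A E) \<xi>))"

definition L_connection :: "('a, 'e::euclidean_space) chart set \<Rightarrow> (('a, 'e) tvec \<Rightarrow> real)
    \<Rightarrow> (('a, 'e) tvec, 'e \<times> 'e) vform \<Rightarrow> (('a, 'e) tvec, 'e \<times> 'e) vform" where
  "L_connection A E L \<xi> = tadd (tadd (berwald_connection A E \<xi>) (L \<xi>))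
     (vform_bracket (tangent_atlas A) (vertical_endo A)
        (finsler_sharp A E (d_along (tangent_atlas A) L E)) \<xi>)"

text \<open>Connections are only used on the nonzero tangent vectors, and so is \<open>d\<^sub>h E = 0\<close>.\<close>

definition conservative :: "('a, 'e::euclidean_space) chart set \<Rightarrow> (('a, 'e) tvec \<Rightarrow> real)
    \<Rightarrow> (('a, 'e) tvec, 'e \<times> 'e) vform \<Rightarrow> bool" where
  "conservative A E h \<longleftrightarrow> (\<forall>v\<in>nonzero_tangent A. \<forall>\<xi>\<in>tangent_space (tangent_atlas A) v.
     d_along (tangent_atlas A) h E \<xi> = 0)"

end

theory Submission
  imports Defs
begin

text \<open>In an induced chart \<open>(x, y)\<close> of \<open>TM\<close>, let \<open>E\<^sub>y\<close> and \<open>E\<^sub>y\<^sub>y\<close> be the first and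
  second derivatives of \<open>E\<close> in the fibre directions. A semibasic \<open>L\<close> has the form
  \<open>(a, b) \<mapsto> (0, l a)\<close>, so that \<open>L\<^sup>\<circ> = (0, l y)\<close> and \<open>L\<^sup>\<circ>E = E\<^sub>y(l y)\<close>. On a vertical and an arbitrary vector
  the fundamental form is \<open>\<omega>((0, s), (a, b)) = E\<^sub>y\<^sub>y(s, a)\<close>. Hence \<open>(d\<^sub>LE)\<^sup>#\<close> is the vertical field \<open>(0, s)\<close>
  with \<open>E\<^sub>y\<^sub>y(s, \<cdot>) = E\<^sub>y(l \<cdot>)\<close>. Homogeneity gives \<open>E\<^sub>y\<^sub>y(y, \<cdot>) = E\<^sub>y\<close>, and so
  \<open>E\<^sub>y(s) = E\<^sub>y\<^sub>y(s, y) = E\<^sub>y(l y) = L\<^sup>\<circ>E\<close>.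

  The bracket \<open>[J, (0, s)]\<close> maps \<open>(a, b)\<close> to \<open>(0, D\<^sub>ys a)\<close>. Therefore the derivative of \<open>E\<close> along
  \<open>L + [J, (d\<^sub>LE)\<^sup>#]\<close> is \<open>E\<^sub>y(l a) + E\<^sub>y(D\<^sub>ys a) = E\<^sub>y\<^sub>y(a, s) + E\<^sub>y(D\<^sub>ys a)\<close>, which is the derivative of
  \<open>E\<^sub>y(s) = L\<^sup>\<circ>E\<close> in direction \<open>(0, a)\<close>. The Berwald connection adds nothing: the vertical derivative of
  the identity \<open>S\<^sub>0E = 0\<close> says that it is conservative. Altogether \<open>d\<^sub>h E = d\<^sub>J (L\<^sup>\<circ>E)\<close> for the
  \<open>L\<close>-connection \<open>h\<close>, which is \<open>d_energy_L_connection\<close>.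

  So \<open>h\<close> is conservative if and only if \<open>L\<^sup>\<circ>E\<close> has no vertical derivative off the zero section. This
  holds if \<open>L\<^sup>\<circ>E\<close> is a vertical lift. Conversely, \<open>L\<^sup>\<circ>E\<close> is then constant along each open ray of a
  fibre, also when the punctured fibre is a disconnected line. As \<open>L\<^sup>\<circ>E\<close> is continuous on \<open>TM\<close> and
  vanishes on the zero section, it vanishes everywhere (\<open>potential_energy_zero\<close>), and \<open>0\<close> is a vertical
  lift.

  The differential, the exterior derivative and the brackets are defined by chosen charts and
  extensions of tangent vectors. Before one can compute with them in coordinates near a point, they
  have to be expressed in an arbitrary chart: \<open>dfun_in_chart\<close>, \<open>lie_bracket_in\<close>,
  \<open>comp_bracket_vertical_endo\<close> and \<open>fundamental_form_in_chart\<close> do this. The fields produced by \<open>\<omega>\<close> are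
  differentiable because they solve linear systems with differentiable coefficients
  (\<open>differentiable_linear_system\<close>).\<close>

section \<open>Calculus on open sets of Euclidean spaces\<close>

abbreviation fderiv :: "('e::real_normed_vector \<Rightarrow> 'b::real_normed_vector) \<Rightarrow> 'e \<Rightarrow> 'e \<Rightarrow> 'b" where
  "fderiv f z \<equiv> frechet_derivative f (at z)"

lemma fderiv_eqI: "(f has_derivative f') (at z) \<Longrightarrow> fderiv f z = f'"
  by (rule frechet_derivative_at[symmetric])

lemma fderiv_works: "f differentiable (at z) \<Longrightarrow> (f has_derivative fderiv f z) (at z)"
  by (simp add: frechet_derivative_works)

lemma linear_fderiv: "f differentiable (at z) \<Longrightarrow> linear (fderiv f z)"
  by (rule linear_frechet_derivative)

lemma has_derivative_cong_open:
  assumes "open U" "z \<in> U" "\<And>x. x \<in> U \<Longrightarrow> f x = g x"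
  shows "(f has_derivative f') (at z) \<longleftrightarrow> (g has_derivative f') (at z)"
  using assms by (metis has_derivative_transform_within_open)

lemma fderiv_cong_open:
  assumes "open U" "z \<in> U" "\<And>x. x \<in> U \<Longrightarrow> f x = g x"
  shows "fderiv f z = fderiv g z"
  unfolding frechet_derivative_def using has_derivative_cong_open[OF assms] by simp

lemma differentiable_cong_open:
  assumes "open U" "z \<in> U" "\<And>x. x \<in> U \<Longrightarrow> f x = g x"
  shows "f differentiable (at z) \<longleftrightarrow> g differentiable (at z)"
  unfolding differentiable_def using has_derivative_cong_open[OF assms] by simp

lemma Ck_on_cong:
  assumes "open U" "\<And>x. x \<in> U \<Longrightarrow> f x = g x"
  shows "Ck_on k U f \<longleftrightarrow> Ck_on k U g"
  using assms(2)
proof (induction k arbitrary: f g)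
  case 0
  then show ?case by (simp cong: continuous_on_cong)
next
  case (Suc k)
  have "Ck_on k U (\<lambda>x. fderiv f x v) \<longleftrightarrow> Ck_on k U (\<lambda>x. fderiv g x v)" for v
    by (rule Suc.IH) (metis fderiv_cong_open[OF assms(1)] Suc.prems)
  moreover have "\<forall>x\<in>U. f differentiable (at x) \<longleftrightarrow> g differentiable (at x)"
    using differentiable_cong_open[OF assms(1)] Suc.prems by blast
  ultimately show ?case by auto
qed

lemma Ck_on_subset: "Ck_on k U f \<Longrightarrow> V \<subseteq> U \<Longrightarrow> Ck_on k V f"
  by (induction k arbitrary: f) (auto intro: continuous_on_subset)

lemma Ck_on_differentiable: "Ck_on (Suc k) U f \<Longrightarrow> x \<in> U \<Longrightarrow> f differentiable (at x)"
  by simp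

lemma Ck_on_SucD: "Ck_on (Suc k) U f \<Longrightarrow> Ck_on k U f"
proof (induction k arbitrary: f)
  case 0
  then show ?case
    by (auto intro!: continuous_at_imp_continuous_on differentiable_imp_continuous_within)
next
  case (Suc k)
  show ?case
    unfolding Ck_on.simps(2)[of k] using Suc.IH Suc.prems[unfolded Ck_on.simps(2)[of "Suc k"]] by blast
qed

lemma Ck_on_const: "Ck_on k U (\<lambda>x. a)"
proof (induction k arbitrary: a)
  case (Suc k)
  then show ?case by (simp add: frechet_derivative_const)
qed simp

lemma Ck_on_bounded_linear:
  assumes "open U" "bounded_linear h" "Ck_on k U f"
  shows "Ck_on k U (\<lambda>x. h (f x))"
  using assms(3)
proof (induction k arbitrary: f)
  case 0
  then show ?case
    using assms(2) by (simp add: linear_continuous_on_compose bounded_linear.linear)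
       (metis bounded_linear.continuous_on)
next
  case (Suc k)
  have der: "((\<lambda>x. h (f x)) has_derivative (\<lambda>v. h (fderiv f x v))) (at x)" if "x \<in> U" for x
    by (rule bounded_linear.has_derivative[OF assms(2)])
       (use Suc.prems that in \<open>simp add: fderiv_works\<close>)
  have "Ck_on k U (\<lambda>x. fderiv (\<lambda>x. h (f x)) x v)" for v
    using Suc.IH[of "\<lambda>x. fderiv f x v"] Suc.prems
    by (subst Ck_on_cong[OF assms(1), where g = "\<lambda>x. h (fderiv f x v)"])
       (auto simp: fderiv_eqI[OF der])
  then show ?case using der by (auto simp: differentiable_def)
qed

lemma Ck_on_add:
  assumes "open U" "Ck_on k U f" "Ck_on k U g"
  shows "Ck_on k U (\<lambda>x. f x + g x)"
  using assms(2,3)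
proof (induction k arbitrary: f g)
  case 0
  then show ?case by (simp add: continuous_on_add)
next
  case (Suc k)
  have der: "((\<lambda>x. f x + g x) has_derivative (\<lambda>v. fderiv f x v + fderiv g x v)) (at x)"
    if "x \<in> U" for x
    using Suc.prems that by (intro has_derivative_add fderiv_works) auto
  have "Ck_on k U (\<lambda>x. fderiv (\<lambda>x. f x + g x) x v)" for v
    using Suc.IH[of "\<lambda>x. fderiv f x v" "\<lambda>x. fderiv g x v"] Suc.prems
    by (subst Ck_on_cong[OF assms(1), where g = "\<lambda>x. fderiv f x v + fderiv g x v"])
       (auto simp: fderiv_eqI[OF der])
  then show ?case using der by (auto simp: differentiable_def)
qed

lemma Ck_on_scaleR:
  fixes a :: "'e::euclidean_space \<Rightarrow> real"
  assumes "open U" "Ck_on k U a" "Ck_on k U f"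
  shows "Ck_on k U (\<lambda>x. a x *\<^sub>R f x)"
  using assms(2,3)
proof (induction k arbitrary: a f)
  case 0
  then show ?case by (simp add: continuous_on_scaleR)
next
  case (Suc k)
  have der: "((\<lambda>x. a x *\<^sub>R f x) has_derivative (\<lambda>v. a x *\<^sub>R fderiv f x v + fderiv a x v *\<^sub>R f x)) (at x)"
    if "x \<in> U" for x
    using Suc.prems that by (intro has_derivative_scaleR fderiv_works) auto
  have "Ck_on k U (\<lambda>x. a x *\<^sub>R fderiv f x v + fderiv a x v *\<^sub>R f x)" for v
    using Suc.prems Ck_on_SucD[OF Suc.prems(1)] Ck_on_SucD[OF Suc.prems(2)]
    by (intro Ck_on_add Suc.IH assms(1)) auto
  then have "Ck_on k U (\<lambda>x. fderiv (\<lambda>x. a x *\<^sub>R f x) x v)" for v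
    by (subst Ck_on_cong[OF assms(1), where g = "\<lambda>x. a x *\<^sub>R fderiv f x v + fderiv a x v *\<^sub>R f x"])
       (auto simp: fderiv_eqI[OF der])
  then show ?case using der by (auto simp: differentiable_def)
qed

lemma Ck_on_sum:
  assumes "open U" "finite I" "\<And>i. i \<in> I \<Longrightarrow> Ck_on k U (f i)"
  shows "Ck_on k U (\<lambda>x. \<Sum>i\<in>I. f i x)"
  using assms(2,3) by (induction I) (auto intro: Ck_on_const Ck_on_add assms(1))

lemma linear_basis_expansion:
  fixes f :: "'e::euclidean_space \<Rightarrow> 'b::real_vector"
  assumes "linear f"
  shows "f v = (\<Sum>i\<in>Basis. (v \<bullet> i) *\<^sub>R f i)"
  by (subst euclidean_representation[of v, symmetric])
     (simp only: linear_sum[OF assms] linear_cmul[OF assms])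

text \<open>The derivative of a composition, expanded in the standard basis, is a sum of products of functions
one order of differentiability lower, so that the order can serve as induction variable.\<close>

lemma Ck_on_compose:
  fixes f :: "'f::euclidean_space \<Rightarrow> 'b::real_normed_vector"
    and g :: "'e::euclidean_space \<Rightarrow> 'f"
  assumes "open U" "open V" "g ` U \<subseteq> V" "Ck_on k U g" "Ck_on k V f"
  shows "Ck_on k U (\<lambda>x. f (g x))"
  using assms(4,5)
proof (induction k arbitrary: f)
  case 0
  then show ?case using assms(3) by (auto intro: continuous_on_compose2)
next
  case (Suc k)
  have der: "((\<lambda>x. f (g x)) has_derivative (\<lambda>v. fderiv f (g x) (fderiv g x v))) (at x)"
    if "x \<in> U" for x
    by (rule has_derivative_compose) (use Suc.prems that assms(3) in \<open>auto intro!: fderiv_works\<close>)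
  have "Ck_on k U (\<lambda>x. \<Sum>i\<in>Basis. (fderiv g x v \<bullet> i) *\<^sub>R fderiv f (g x) i)" for v
    using Suc.prems Ck_on_SucD[OF Suc.prems(1)]
    by (intro Ck_on_sum Ck_on_scaleR Suc.IH assms(1) finite_Basis
          Ck_on_bounded_linear[OF assms(1) bounded_linear_inner_left]) auto
  moreover have "fderiv (\<lambda>x. f (g x)) x v = (\<Sum>i\<in>Basis. (fderiv g x v \<bullet> i) *\<^sub>R fderiv f (g x) i)"
    if "x \<in> U" for x v
    using Suc.prems that assms(3)
    by (auto simp: fderiv_eqI[OF der] intro!: linear_basis_expansion linear_fderiv)
  ultimately have "Ck_on k U (\<lambda>x. fderiv (\<lambda>x. f (g x)) x v)" for v
    by (subst Ck_on_cong[OF assms(1)]) auto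
  then show ?case using der by (auto simp: differentiable_def)
qed

lemma smooth_on_cong:
  "open U \<Longrightarrow> (\<And>x. x \<in> U \<Longrightarrow> f x = g x) \<Longrightarrow> smooth_on U f \<longleftrightarrow> smooth_on U g"
  unfolding smooth_on_def using Ck_on_cong by metis

lemma smooth_on_subset: "smooth_on U f \<Longrightarrow> V \<subseteq> U \<Longrightarrow> smooth_on V f"
  unfolding smooth_on_def using Ck_on_subset by blast

lemma smooth_on_fderiv: "smooth_on U f \<Longrightarrow> smooth_on U (\<lambda>x. fderiv f x v)"
  unfolding smooth_on_def using Ck_on.simps(2) by blast

lemma smooth_on_differentiable: "smooth_on U f \<Longrightarrow> x \<in> U \<Longrightarrow> f differentiable (at x)"
  unfolding smooth_on_def using Ck_on_differentiable by blast

lemma smooth_on_continuous_on: "smooth_on U f \<Longrightarrow> continuous_on U f"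
  unfolding smooth_on_def using Ck_on.simps(1) by blast

lemma smooth_on_compose:
  fixes f :: "'f::euclidean_space \<Rightarrow> 'b::real_normed_vector"
    and g :: "'e::euclidean_space \<Rightarrow> 'f"
  assumes "open U" "open V" "g ` U \<subseteq> V" "smooth_on U g" "smooth_on V f"
  shows "smooth_on U (\<lambda>x. f (g x))"
  using assms Ck_on_compose unfolding smooth_on_def by blast

lemma smooth_on_bounded_linear:
  "open U \<Longrightarrow> bounded_linear h \<Longrightarrow> smooth_on U f \<Longrightarrow> smooth_on U (\<lambda>x. h (f x))"
  unfolding smooth_on_def using Ck_on_bounded_linear by blast

lemma smooth_on_ident:
  assumes "open (U :: 'e::euclidean_space set)"
  shows "smooth_on U (\<lambda>x. x)"
  unfolding smooth_on_def
proof
  fix k show "Ck_on k U (\<lambda>x. x)"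
    by (cases k) (simp_all add: frechet_derivative_ident[unfolded id_def] Ck_on_const)
qed

lemma smooth_on_linear:
  assumes "open U" "bounded_linear h"
  shows "smooth_on U h"
  using smooth_on_bounded_linear[OF assms smooth_on_ident[OF assms(1)]] by simp

lemma smooth_on_Pair:
  assumes "open U" "smooth_on U f" "smooth_on U g"
  shows "smooth_on U (\<lambda>x. (f x, g x))"
proof -
  have "Ck_on k U (\<lambda>x. (f x, 0) + (0, g x))" for k
    using assms(2,3) unfolding smooth_on_def
    by (intro Ck_on_add[OF assms(1)]
        Ck_on_bounded_linear[OF assms(1) bounded_linear_Pair[OF bounded_linear_ident bounded_linear_zero]]
        Ck_on_bounded_linear[OF assms(1) bounded_linear_Pair[OF bounded_linear_zero bounded_linear_ident]])
       auto
  then show ?thesis by (simp add: smooth_on_def)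
qed

text \<open>A family of linear maps, differentiable at each fixed argument, behaves like a bilinear
  expression: the product rule is available although no topology on the space of linear maps
  is mentioned.\<close>

lemma has_derivative_linear_family:
  fixes F :: "'z::real_normed_vector \<Rightarrow> 'e::euclidean_space \<Rightarrow> 'b::real_normed_vector"
  assumes "open U" "z \<in> U" and lin: "\<And>x. x \<in> U \<Longrightarrow> linear (F x)"
    and F: "\<And>w. (\<lambda>x. F x w) differentiable (at z)"
    and g: "(g has_derivative g') (at z)"
  shows "((\<lambda>x. F x (g x)) has_derivative
    (\<lambda>u. fderiv (\<lambda>x. F x (g z)) z u + F z (g' u))) (at z)"
proof -
  have expansion: "((\<lambda>x. F x (h x)) has_derivative
      (\<lambda>u. \<Sum>i\<in>Basis. (h z \<bullet> i) *\<^sub>R fderiv (\<lambda>x. F x i) z u + (h' u \<bullet> i) *\<^sub>R F z i)) (at z)"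
    if h: "(h has_derivative h') (at z)" for h h'
  proof -
    have "((\<lambda>x. \<Sum>i\<in>Basis. (h x \<bullet> i) *\<^sub>R F x i) has_derivative
      (\<lambda>u. \<Sum>i\<in>Basis. (h z \<bullet> i) *\<^sub>R fderiv (\<lambda>x. F x i) z u + (h' u \<bullet> i) *\<^sub>R F z i)) (at z)"
      by (intro has_derivative_sum has_derivative_scaleR has_derivative_inner_left h
          fderiv_works F)
    then show ?thesis
      by (rule has_derivative_transform_within_open[OF _ assms(1,2)])
         (rule linear_basis_expansion[OF lin, symmetric])
  qed
  have const: "fderiv (\<lambda>x. F x (g z)) z = (\<lambda>u. \<Sum>i\<in>Basis. (g z \<bullet> i) *\<^sub>R fderiv (\<lambda>x. F x i) z u)"
    using expansion[OF has_derivative_const[of "g z"]] by (intro fderiv_eqI) simp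
  show ?thesis
    unfolding const using expansion[OF g]
    by (simp add: sum.distrib linear_basis_expansion[OF lin[OF assms(2)], of "g' _"])
qed

lemma smooth_on_linear_family:
  fixes F :: "'z::euclidean_space \<Rightarrow> 'e::euclidean_space \<Rightarrow> 'b::real_normed_vector"
  assumes "open U" and "\<And>x. x \<in> U \<Longrightarrow> linear (F x)"
    and "\<And>w. smooth_on U (\<lambda>x. F x w)" and "smooth_on U g"
  shows "smooth_on U (\<lambda>x. F x (g x))"
proof -
  have "Ck_on k U (\<lambda>x. \<Sum>i\<in>Basis. (g x \<bullet> i) *\<^sub>R F x i)" for k
    using assms(3,4) unfolding smooth_on_def
    by (intro Ck_on_sum Ck_on_scaleR assms(1) finite_Basis
          Ck_on_bounded_linear[OF assms(1) bounded_linear_inner_left]) auto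
  then have "smooth_on U (\<lambda>x. \<Sum>i\<in>Basis. (g x \<bullet> i) *\<^sub>R F x i)"
    by (simp add: smooth_on_def)
  then show ?thesis
    by (subst smooth_on_cong[OF assms(1) linear_basis_expansion[OF assms(2)]])
qed

lemma continuous_on_linear_family:
  fixes F :: "'z::topological_space \<Rightarrow> 'e::euclidean_space \<Rightarrow> 'b::real_normed_vector"
  assumes "\<And>x. x \<in> U \<Longrightarrow> linear (F x)" "\<And>w. continuous_on U (\<lambda>x. F x w)" "continuous_on U g"
  shows "continuous_on U (\<lambda>x. F x (g x))"
proof -
  have "continuous_on U (\<lambda>x. \<Sum>i\<in>Basis. (g x \<bullet> i) *\<^sub>R F x i)"
    by (intro continuous_intros assms)
  then show ?thesis
    by (rule continuous_on_eq) (rule linear_basis_expansion[OF assms(1), symmetric])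
qed

subsection \<open>Symmetry of the second derivative\<close>

lemma has_real_derivative_along_line:
  fixes f :: "'e::real_normed_vector \<Rightarrow> real"
  assumes "f differentiable (at (y + r *\<^sub>R v))"
  shows "((\<lambda>r. f (y + r *\<^sub>R v)) has_real_derivative fderiv f (y + r *\<^sub>R v) v) (at r)"
proof -
  have "((\<lambda>r. y + r *\<^sub>R v) has_derivative (\<lambda>t. t *\<^sub>R v)) (at r)"
    by (auto intro!: derivative_eq_intros)
  from has_derivative_compose[OF this fderiv_works[OF assms]] show ?thesis
    by (simp add: has_field_derivative_def linear_cmul[OF linear_fderiv[OF assms]]
        mult.commute[of _ "fderiv _ _ _"])
qed

text \<open>The mean value theorem, applied first to the increment in direction \<open>v\<close> as a function of the
step in direction \<open>u\<close> and then to the derivative so obtained.\<close>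

lemma second_difference_mean_value:
  fixes f :: "'e::euclidean_space \<Rightarrow> real"
  assumes "s > 0"
    and f: "\<And>a b. \<lbrakk>0 \<le> a; a \<le> s; 0 \<le> b; b \<le> s\<rbrakk> \<Longrightarrow> f differentiable (at (x + a *\<^sub>R u + b *\<^sub>R v))"
    and g: "\<And>a b. \<lbrakk>0 \<le> a; a \<le> s; 0 \<le> b; b \<le> s\<rbrakk> \<Longrightarrow>
      (\<lambda>z. fderiv f z u) differentiable (at (x + a *\<^sub>R u + b *\<^sub>R v))"
  shows "\<exists>a b. 0 < a \<and> a < s \<and> 0 < b \<and> b < s \<and>
    f (x + s *\<^sub>R u + s *\<^sub>R v) - f (x + s *\<^sub>R u) - f (x + s *\<^sub>R v) + f x
      = s\<^sup>2 * fderiv (\<lambda>z. fderiv f z u) (x + a *\<^sub>R u + b *\<^sub>R v) v"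
proof -
  define \<psi> where "\<psi> r = f (x + r *\<^sub>R u + s *\<^sub>R v) - f (x + r *\<^sub>R u)" for r
  have \<psi>': "DERIV \<psi> r :> fderiv f (x + r *\<^sub>R u + s *\<^sub>R v) u - fderiv f (x + r *\<^sub>R u) u"
    if "0 \<le> r" "r \<le> s" for r
  proof -
    have d1: "f differentiable (at (x + r *\<^sub>R u + s *\<^sub>R v))" using f[of r s] that assms(1) by simp
    have d2: "f differentiable (at (x + r *\<^sub>R u))" using f[of r 0] that assms(1) by simp
    show ?thesis
      unfolding \<psi>_def
      using DERIV_diff[OF has_real_derivative_along_line[of f "x + s *\<^sub>R v" r u]
          has_real_derivative_along_line[OF d2]] d1
      by (simp add: add_ac)
  qed
  obtain a where a: "0 < a" "a < s"
    "\<psi> s - \<psi> 0 = (s - 0) * (fderiv f (x + a *\<^sub>R u + s *\<^sub>R v) u - fderiv f (x + a *\<^sub>R u) u)"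
    using MVT2[OF assms(1), of \<psi>, OF \<psi>'] by blast
  define \<phi> where "\<phi> r = fderiv f (x + a *\<^sub>R u + r *\<^sub>R v) u" for r
  have \<phi>': "DERIV \<phi> r :> fderiv (\<lambda>z. fderiv f z u) (x + a *\<^sub>R u + r *\<^sub>R v) v"
    if "0 \<le> r" "r \<le> s" for r
  proof -
    have d: "(\<lambda>z. fderiv f z u) differentiable (at (x + a *\<^sub>R u + r *\<^sub>R v))"
      using g[of a r] that a by simp
    show ?thesis
      unfolding \<phi>_def by (rule has_real_derivative_along_line[OF d])
  qed
  obtain b where b: "0 < b" "b < s"
    "\<phi> s - \<phi> 0 = (s - 0) * fderiv (\<lambda>z. fderiv f z u) (x + a *\<^sub>R u + b *\<^sub>R v) v"
    using MVT2[OF assms(1), of \<phi>, OF \<phi>'] by blast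
  have "\<psi> s - \<psi> 0 = s\<^sup>2 * fderiv (\<lambda>z. fderiv f z u) (x + a *\<^sub>R u + b *\<^sub>R v) v"
    using a(3) b(3) by (simp add: \<phi>_def power2_eq_square)
  then show ?thesis
    using a(1,2) b(1,2) by (intro exI[of _ a] exI[of _ b]) (simp add: \<psi>_def algebra_simps)
qed

text \<open>Both iterated derivatives are limits of the same second difference quotient.\<close>

lemma second_derivative_symmetric_real:
  fixes f :: "'e::euclidean_space \<Rightarrow> real"
  assumes "open U" "x \<in> U" "Ck_on 2 U f"
  shows "fderiv (\<lambda>z. fderiv f z u) x v = fderiv (\<lambda>z. fderiv f z v) x u"
proof -
  define g where "g u v z = fderiv (\<lambda>z. fderiv f z u) z v" for u v z
  have C: "Ck_on (Suc (Suc 0)) U f" using assms(3) by (simp add: numeral_2_eq_2)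
  have cont: "isCont (g u v) x" for u v
    using C assms(1,2) unfolding g_def
    by (auto simp: continuous_on_eq_continuous_at)
  have "dist (g u v x) (g v u x) \<le> \<epsilon>" if "\<epsilon> > 0" for \<epsilon>
  proof -
    obtain d1 where d1: "d1 > 0" "\<And>z. dist z x < d1 \<Longrightarrow> dist (g u v z) (g u v x) < \<epsilon> / 2"
      using cont[of u v, unfolded continuous_at_eps_delta, rule_format, of "\<epsilon> / 2"] \<open>\<epsilon> > 0\<close>
      unfolding dist_norm by (meson half_gt_zero)
    obtain d2 where d2: "d2 > 0" "\<And>z. dist z x < d2 \<Longrightarrow> dist (g v u z) (g v u x) < \<epsilon> / 2"
      using cont[of v u, unfolded continuous_at_eps_delta, rule_format, of "\<epsilon> / 2"] \<open>\<epsilon> > 0\<close>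
      unfolding dist_norm by (meson half_gt_zero)
    obtain d3 where d3: "d3 > 0" "ball x d3 \<subseteq> U"
      using assms(1,2) open_contains_ball by blast
    (* s is chosen such that the parallelogram of all x + a u + b v with a, b between 0 and s lies in
       the ball of radius d around x *)
    define d where "d = min d1 (min d2 d3)"
    define s where "s = d / (2 * (norm u + norm v + 1))"
    have "d > 0" using d1(1) d2(1) d3(1) by (simp add: d_def)
    have pos: "norm u + norm v + 1 > 0"
      by (simp add: add_nonneg_pos)
    have "s > 0" using \<open>d > 0\<close> pos by (simp add: s_def)
    have near: "dist (x + a *\<^sub>R u + b *\<^sub>R v) x < d" if "0 \<le> a" "a \<le> s" "0 \<le> b" "b \<le> s" for a b
    proof -
      have "dist (x + a *\<^sub>R u + b *\<^sub>R v) x = norm (a *\<^sub>R u + b *\<^sub>R v)" by (simp add: dist_norm algebra_simps)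
      also have "\<dots> \<le> a * norm u + b * norm v"
        using that by (intro norm_triangle_le) simp
      also have "\<dots> \<le> s * norm u + s * norm v"
        using that by (intro add_mono mult_right_mono) auto
      also have "\<dots> < 2 * (s * (norm u + norm v + 1))"
        using \<open>s > 0\<close> pos by (simp add: algebra_simps) (smt (verit) mult_nonneg_nonneg norm_ge_zero)
      also have "\<dots> = d" using less_imp_neq[OF pos] unfolding s_def by (metis (no_types)
        divide_divide_eq_left mult.commute nonzero_eq_divide_eq times_divide_eq_left zero_neq_numeral)
      finally show ?thesis .
    qed
    have inU: "x + a *\<^sub>R u + b *\<^sub>R v \<in> U" if "0 \<le> a" "a \<le> s" "0 \<le> b" "b \<le> s" for a b
      using near[OF that] d3(2) by (auto simp: d_def dist_commute)
    have inU': "x + b *\<^sub>R v + a *\<^sub>R u \<in> U" if "0 \<le> a" "a \<le> s" "0 \<le> b" "b \<le> s" for a b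
      using inU[OF that] by (simp add: algebra_simps)
    obtain a b where ab: "0 < a" "a < s" "0 < b" "b < s"
      "f (x + s *\<^sub>R u + s *\<^sub>R v) - f (x + s *\<^sub>R u) - f (x + s *\<^sub>R v) + f x
        = s\<^sup>2 * g u v (x + a *\<^sub>R u + b *\<^sub>R v)"
      using second_difference_mean_value[OF \<open>s > 0\<close>, of f x u v] C inU unfolding g_def
      by auto
    obtain b' a' where ab': "0 < b'" "b' < s" "0 < a'" "a' < s"
      "f (x + s *\<^sub>R v + s *\<^sub>R u) - f (x + s *\<^sub>R v) - f (x + s *\<^sub>R u) + f x
        = s\<^sup>2 * g v u (x + b' *\<^sub>R v + a' *\<^sub>R u)"
      using second_difference_mean_value[OF \<open>s > 0\<close>, of f x v u] C inU' unfolding g_def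
      by auto
    have "s\<^sup>2 * g u v (x + a *\<^sub>R u + b *\<^sub>R v) = s\<^sup>2 * g v u (x + b' *\<^sub>R v + a' *\<^sub>R u)"
      using ab(5) ab'(5) by (simp add: algebra_simps)
    then have eq: "g u v (x + a *\<^sub>R u + b *\<^sub>R v) = g v u (x + a' *\<^sub>R u + b' *\<^sub>R v)"
      using \<open>s > 0\<close> by (simp add: algebra_simps)
    have "dist (g u v (x + a *\<^sub>R u + b *\<^sub>R v)) (g u v x) < \<epsilon> / 2"
      using near[of a b] ab by (intro d1(2)) (auto simp: d_def)
    moreover have "dist (g v u (x + a' *\<^sub>R u + b' *\<^sub>R v)) (g v u x) < \<epsilon> / 2"
      using near[of a' b'] ab' by (intro d2(2)) (auto simp: d_def)
    ultimately show ?thesis unfolding eq by (smt (verit) dist_commute dist_triangle field_sum_of_halves)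
  qed
  then have "dist (g u v x) (g v u x) \<le> 0" by (rule field_le_epsilon[of _ 0, simplified])
  then show ?thesis by (simp add: g_def)
qed

lemma second_derivative_symmetric:
  fixes f :: "'e::euclidean_space \<Rightarrow> 'b::euclidean_space"
  assumes "open U" "x \<in> U" "smooth_on U f"
  shows "fderiv (\<lambda>z. fderiv f z u) x v = fderiv (\<lambda>z. fderiv f z v) x u"
proof (rule euclidean_eqI)
  fix i :: 'b assume "i \<in> Basis"
  have comp: "fderiv (\<lambda>z. h z \<bullet> i) y w = fderiv h y w \<bullet> i" if "smooth_on U h" "y \<in> U"
    for h :: "'e \<Rightarrow> 'b" and y w
    using fun_cong[OF fderiv_eqI[OF has_derivative_inner_left[OF
          fderiv_works[OF smooth_on_differentiable[OF that]]]]] by simp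
  have "fderiv (\<lambda>z. fderiv f z u) x v \<bullet> i = fderiv (\<lambda>z. fderiv (\<lambda>z. f z \<bullet> i) z u) x v" for u v
    using comp[OF smooth_on_fderiv[OF assms(3)] assms(2)]
      fderiv_cong_open[OF assms(1,2), of "\<lambda>z. fderiv (\<lambda>z. f z \<bullet> i) z u" "\<lambda>z. fderiv f z u \<bullet> i"]
      comp[OF assms(3)] by simp
  moreover have "Ck_on 2 U (\<lambda>z. f z \<bullet> i)"
    using smooth_on_bounded_linear[OF assms(1) bounded_linear_inner_left assms(3), of i]
    by (simp add: smooth_on_def)
  ultimately show "fderiv (\<lambda>z. fderiv f z u) x v \<bullet> i = fderiv (\<lambda>z. fderiv f z v) x u \<bullet> i"
    using second_derivative_symmetric_real[OF assms(1,2)] by simp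
qed

section \<open>Charts, tangent vectors and vector fields\<close>

locale atlas =
  fixes B :: "('b, 'f::euclidean_space) chart set"
  assumes smooth_atlas: "smooth_atlas B"
begin

lemma charts_atD: "c \<in> charts_at B p \<Longrightarrow> c \<in> B" "c \<in> charts_at B p \<Longrightarrow> p \<in> cdom c"
  by (simp_all add: charts_at_def)

lemma inj_on_cmap: "c \<in> B \<Longrightarrow> inj_on (cmap c) (cdom c)"
  using smooth_atlas by (simp add: smooth_atlas_def)

lemma cinv_cmap: "c \<in> B \<Longrightarrow> p \<in> cdom c \<Longrightarrow> cinv c (cmap c p) = p"
  by (simp add: cinv_def inj_on_cmap)

lemma open_chart_image: "c \<in> B \<Longrightarrow> open (cmap c ` cdom c)"
  using smooth_atlas by (simp add: smooth_atlas_def)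

lemma open_overlap: "c \<in> B \<Longrightarrow> d \<in> B \<Longrightarrow> open (cmap c ` (cdom c \<inter> cdom d))"
  using smooth_atlas by (simp add: smooth_atlas_def)

lemma smooth_transition:
  "c \<in> B \<Longrightarrow> d \<in> B \<Longrightarrow> smooth_on (cmap c ` (cdom c \<inter> cdom d)) (cmap d \<circ> cinv c)"
  using smooth_atlas by (simp add: smooth_atlas_def)

lemma transition_differentiable:
  "c \<in> charts_at B p \<Longrightarrow> d \<in> charts_at B p \<Longrightarrow> (cmap d \<circ> cinv c) differentiable (at (cmap c p))"
  by (rule smooth_on_differentiable[OF smooth_transition]) (auto simp: charts_at_def)

lemma linear_fderiv_transition:
  "c \<in> charts_at B p \<Longrightarrow> d \<in> charts_at B p \<Longrightarrow> linear (fderiv (cmap d \<circ> cinv c) (cmap c p))"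
  by (rule linear_fderiv[OF transition_differentiable])

lemma fderiv_transition_cocycle:
  assumes c: "c \<in> charts_at B p" and d: "d \<in> charts_at B p" and e: "e \<in> charts_at B p"
  shows "fderiv (cmap e \<circ> cinv c) (cmap c p) u
    = fderiv (cmap e \<circ> cinv d) (cmap d p) (fderiv (cmap d \<circ> cinv c) (cmap c p) u)"
proof -
  have p: "cinv c (cmap c p) = p" using c by (simp add: charts_at_def cinv_cmap)
  have "((\<lambda>z. (cmap e \<circ> cinv d) ((cmap d \<circ> cinv c) z)) has_derivative
     (\<lambda>u. fderiv (cmap e \<circ> cinv d) (cmap d p) (fderiv (cmap d \<circ> cinv c) (cmap c p) u))) (at (cmap c p))"
    using has_derivative_compose[OF fderiv_works[OF transition_differentiable[OF c d]],
        of "cmap e \<circ> cinv d" "fderiv (cmap e \<circ> cinv d) (cmap d p)"]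
      fderiv_works[OF transition_differentiable[OF d e]] p by simp
  then have "((cmap e \<circ> cinv c) has_derivative
     (\<lambda>u. fderiv (cmap e \<circ> cinv d) (cmap d p) (fderiv (cmap d \<circ> cinv c) (cmap c p) u))) (at (cmap c p))"
    by (rule has_derivative_transform_within_open[OF _ open_overlap[of c d]])
       (use c d in \<open>auto simp: charts_at_def cinv_cmap\<close>)
  then show ?thesis by (simp add: fderiv_eqI)
qed

lemma fderiv_transition_self:
  assumes "c \<in> charts_at B p"
  shows "fderiv (cmap c \<circ> cinv c) (cmap c p) u = u"
proof -
  have "((cmap c \<circ> cinv c) has_derivative (\<lambda>u. u)) (at (cmap c p))"
    by (rule has_derivative_transform_within_open[OF has_derivative_ident open_chart_image[of c]])
       (use assms in \<open>auto simp: charts_at_def cinv_cmap\<close>)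
  then show ?thesis by (simp add: fderiv_eqI)
qed

subsection \<open>Tangent vectors\<close>

text \<open>Inverse to taking the component in the chart \<open>c\<close>.\<close>

definition tangent_vector :: "('b, 'f) chart \<Rightarrow> 'b \<Rightarrow> 'f \<Rightarrow> ('b, 'f) tvec" where
  "tangent_vector c p u = tvec_at B p (\<lambda>d. fderiv (cmap d \<circ> cinv c) (cmap c p) u)"

lemma base_tangent_vector: "base (tangent_vector c p u) = p"
  by (simp add: tangent_vector_def tvec_at_def)

lemma comp_tangent_vector:
  "d \<in> charts_at B p \<Longrightarrow> comp (tangent_vector c p u) d = fderiv (cmap d \<circ> cinv c) (cmap c p) u"
  by (simp add: tangent_vector_def tvec_at_def)

lemma comp_tangent_vector_self: "c \<in> charts_at B p \<Longrightarrow> comp (tangent_vector c p u) c = u"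
  by (simp add: comp_tangent_vector fderiv_transition_self)

lemma tangent_vector_in: "c \<in> charts_at B p \<Longrightarrow> tangent_vector c p u \<in> tangent_space B p"
  by (auto simp: tangent_space_def tangent_vector_def tvec_at_def intro: fderiv_transition_cocycle)

lemma comp_transform:
  "\<xi> \<in> tangent_space B p \<Longrightarrow> c \<in> charts_at B p \<Longrightarrow> d \<in> charts_at B p \<Longrightarrow>
   comp \<xi> d = fderiv (cmap d \<circ> cinv c) (cmap c p) (comp \<xi> c)"
  unfolding tangent_space_def by blast

lemma comp_outside: "\<xi> \<in> tangent_space B p \<Longrightarrow> c \<notin> charts_at B p \<Longrightarrow> comp \<xi> c = 0"
  unfolding tangent_space_def by blast

lemma base_eq: "\<xi> \<in> tangent_space B p \<Longrightarrow> base \<xi> = p"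
  unfolding tangent_space_def by blast

lemma tangent_vector_comp:
  assumes "\<xi> \<in> tangent_space B p" "c \<in> charts_at B p"
  shows "tangent_vector c p (comp \<xi> c) = \<xi>"
proof -
  have "comp (tangent_vector c p (comp \<xi> c)) d = comp \<xi> d" for d
    using comp_transform[OF assms, of d] comp_outside[OF assms(1), of d]
      comp_outside[OF tangent_vector_in[OF assms(2)], of d]
    by (cases "d \<in> charts_at B p") (simp_all add: comp_tangent_vector)
  then show ?thesis
    by (intro tvec.expand) (simp add: base_tangent_vector base_eq[OF assms(1)] fun_eq_iff)
qed

lemma tangent_space_eqI:
  "\<xi> \<in> tangent_space B p \<Longrightarrow> \<eta> \<in> tangent_space B p \<Longrightarrow> c \<in> charts_at B p \<Longrightarrow>
   comp \<xi> c = comp \<eta> c \<Longrightarrow> \<xi> = \<eta>"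
  by (metis tangent_vector_comp)

lemma tangent_spaceI:
  assumes "base \<xi> = p" "\<And>c. c \<notin> charts_at B p \<Longrightarrow> comp \<xi> c = 0"
    and "\<And>c d. c \<in> charts_at B p \<Longrightarrow> d \<in> charts_at B p \<Longrightarrow>
      comp \<xi> d = fderiv (cmap d \<circ> cinv c) (cmap c p) (comp \<xi> c)"
  shows "\<xi> \<in> tangent_space B p"
  using assms unfolding tangent_space_def by blast

lemma tadd_in:
  assumes \<xi>: "\<xi> \<in> tangent_space B p" and \<eta>: "\<eta> \<in> tangent_space B p"
  shows "tadd \<xi> \<eta> \<in> tangent_space B p"
proof (rule tangent_spaceI)
  fix c d assume cd: "c \<in> charts_at B p" "d \<in> charts_at B p"
  show "comp (tadd \<xi> \<eta>) d = fderiv (cmap d \<circ> cinv c) (cmap c p) (comp (tadd \<xi> \<eta>) c)"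
    using comp_transform[OF \<xi> cd] comp_transform[OF \<eta> cd]
    by (simp add: tadd_def linear_add[OF linear_fderiv_transition[OF cd]])
qed (simp_all add: tadd_def base_eq[OF \<xi>] comp_outside[OF \<xi>] comp_outside[OF \<eta>])

lemma tscale_in:
  assumes \<xi>: "\<xi> \<in> tangent_space B p"
  shows "tscale r \<xi> \<in> tangent_space B p"
proof (rule tangent_spaceI)
  fix c d assume cd: "c \<in> charts_at B p" "d \<in> charts_at B p"
  show "comp (tscale r \<xi>) d = fderiv (cmap d \<circ> cinv c) (cmap c p) (comp (tscale r \<xi>) c)"
    using comp_transform[OF \<xi> cd]
    by (simp add: tscale_def linear_cmul[OF linear_fderiv_transition[OF cd]])
qed (simp_all add: tscale_def base_eq[OF \<xi>] comp_outside[OF \<xi>])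

lemma tzero_in: "tzero p \<in> tangent_space B p"
  by (rule tangent_spaceI) (simp_all add: tzero_def linear_0[OF linear_fderiv_transition])

lemma chart_at_in: "p \<in> points B \<Longrightarrow> chart_at B p \<in> charts_at B p"
  unfolding chart_at_def by (rule someI_ex) (auto simp: points_def charts_at_def)

lemma points_iff: "p \<in> points B \<longleftrightarrow> charts_at B p \<noteq> {}"
  by (auto simp: points_def charts_at_def)

subsection \<open>The manifold topology\<close>

lemma istopology_manifold:
  "istopology (\<lambda>V. V \<subseteq> points B \<and> (\<forall>c\<in>B. open (cmap c ` (V \<inter> cdom c))))"
proof -
  have "cmap c ` (V \<inter> W \<inter> cdom c) = cmap c ` (V \<inter> cdom c) \<inter> cmap c ` (W \<inter> cdom c)"
    if "c \<in> B" for c V W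
    using inj_on_cmap[OF that] by (auto simp: inj_on_def)
  moreover have "cmap c ` (\<Union>\<K> \<inter> cdom c) = (\<Union>V\<in>\<K>. cmap c ` (V \<inter> cdom c))"
    for c :: "('b, 'f) chart" and \<K>
    by auto
  ultimately show ?thesis by (auto simp: istopology_def)
qed

lemma openin_manifold:
  "openin (manifold_topology B) V \<longleftrightarrow> V \<subseteq> points B \<and> (\<forall>c\<in>B. open (cmap c ` (V \<inter> cdom c)))"
  unfolding manifold_topology_def topology_inverse'[OF istopology_manifold] by (rule refl)

lemma openin_chart_domain: "c \<in> B \<Longrightarrow> openin (manifold_topology B) (cdom c)"
  using open_overlap by (auto simp: openin_manifold points_def Int_commute)

lemma open_chart_image_Int:
  "openin (manifold_topology B) V \<Longrightarrow> c \<in> B \<Longrightarrow> open (cmap c ` (V \<inter> cdom c))"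
  by (simp add: openin_manifold)

subsection \<open>Functions and vector fields in charts\<close>

text \<open>By the chain rule the differential, which is defined by one chosen chart, can be computed in
every chart.\<close>

lemma dfun_in_chart:
  assumes \<xi>: "\<xi> \<in> tangent_space B p" and c: "c \<in> charts_at B p"
    and f: "(f \<circ> cinv c) differentiable (at (cmap c p))"
  shows "dfun B f \<xi> = fderiv (f \<circ> cinv c) (cmap c p) (comp \<xi> c)"
proof -
  define d where "d = chart_at B p"
  have d: "d \<in> charts_at B p"
    using chart_at_in c points_iff unfolding d_def by blast
  have p: "cinv d (cmap d p) = p" using d by (simp add: charts_at_def cinv_cmap)
  have "((\<lambda>z. (f \<circ> cinv c) ((cmap c \<circ> cinv d) z)) has_derivative
     (\<lambda>u. fderiv (f \<circ> cinv c) (cmap c p) (fderiv (cmap c \<circ> cinv d) (cmap d p) u))) (at (cmap d p))"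
    using has_derivative_compose[OF fderiv_works[OF transition_differentiable[OF d c]],
        of "f \<circ> cinv c" "fderiv (f \<circ> cinv c) (cmap c p)"]
      fderiv_works[OF f] p by simp
  then have "((f \<circ> cinv d) has_derivative
     (\<lambda>u. fderiv (f \<circ> cinv c) (cmap c p) (fderiv (cmap c \<circ> cinv d) (cmap d p) u))) (at (cmap d p))"
    by (rule has_derivative_transform_within_open[OF _ open_overlap[of d c]])
       (use c d in \<open>auto simp: charts_at_def cinv_cmap\<close>)
  then have "fderiv (f \<circ> cinv d) (cmap d p) (comp \<xi> d)
      = fderiv (f \<circ> cinv c) (cmap c p) (comp \<xi> c)"
    using comp_transform[OF \<xi> d c] by (simp add: fderiv_eqI)
  then show ?thesis
    using base_eq[OF \<xi>] by (simp add: dfun_def d_def)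
qed

lemma vfcomp_transform:
  assumes "X p \<in> tangent_space B p" "c \<in> charts_at B p" "d \<in> charts_at B p"
  shows "vfcomp d X (cmap d p) = fderiv (cmap d \<circ> cinv c) (cmap c p) (vfcomp c X (cmap c p))"
  using comp_transform[OF assms] assms by (simp add: vfcomp_def cinv_cmap charts_at_def)

lemma smooth_vfieldD:
  assumes "smooth_vfield B V X" "p \<in> V"
  shows "X p \<in> tangent_space B p"
    and "c \<in> charts_at B p \<Longrightarrow> vfcomp c X differentiable (at (cmap c p))"
proof -
  show "X p \<in> tangent_space B p"
    using assms by (simp add: smooth_vfield_def Ck_vfield_def)
  show "vfcomp c X differentiable (at (cmap c p))" if "c \<in> charts_at B p"
  proof -
    have "Ck_on (Suc 0) (cmap c ` (V \<inter> cdom c)) (vfcomp c X)"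
      using assms(1) that by (simp only: smooth_vfield_def Ck_vfield_def charts_at_def) blast
    then show ?thesis
      by (rule Ck_on_differentiable) (use assms(2) that in \<open>auto simp: charts_at_def\<close>)
  qed
qed

text \<open>These fields show that every tangent vector extends to a smooth field. Their components in another
chart are derivatives of the transition map, composed with its inverse.\<close>

lemma smooth_vfield_constant_in_chart:
  assumes c: "c \<in> B"
  shows "smooth_vfield B (cdom c) (\<lambda>q. tangent_vector c q u)"
proof -
  have "smooth_on (cmap d ` (cdom c \<inter> cdom d)) (vfcomp d (\<lambda>q. tangent_vector c q u))"
    if d: "d \<in> B" for d
  proof -
    let ?U = "cmap d ` (cdom d \<inter> cdom c)" and ?V = "cmap c ` (cdom c \<inter> cdom d)"
    have img: "(cmap c \<circ> cinv d) ` ?U \<subseteq> ?V"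
      using cinv_cmap[OF d] by auto
    have "smooth_on ?U (\<lambda>z. fderiv (cmap d \<circ> cinv c) ((cmap c \<circ> cinv d) z) u)"
      by (rule smooth_on_compose[OF open_overlap[OF d c] open_overlap[OF c d] img
            smooth_transition[OF d c] smooth_on_fderiv[OF smooth_transition[OF c d]]])
    moreover have "fderiv (cmap d \<circ> cinv c) ((cmap c \<circ> cinv d) z) u
        = vfcomp d (\<lambda>q. tangent_vector c q u) z" if "z \<in> ?U" for z
    proof -
      obtain q where "z = cmap d q" "q \<in> cdom c" "q \<in> cdom d" using \<open>z \<in> ?U\<close> by auto
      then show ?thesis
        using c d by (simp add: vfcomp_def cinv_cmap comp_tangent_vector charts_at_def)
    qed
    ultimately show ?thesis
      by (subst (asm) smooth_on_cong[OF open_overlap[OF d c]]) (auto simp: Int_commute)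
  qed
  moreover have "tangent_vector c q u \<in> tangent_space B q" if "q \<in> cdom c" for q
    using that c by (intro tangent_vector_in) (simp add: charts_at_def)
  ultimately show ?thesis
    by (simp add: smooth_vfield_def Ck_vfield_def smooth_on_def)
qed

lemma extension:
  assumes "p \<in> points B" "\<xi> \<in> tangent_space B p"
  obtains V where "openin (manifold_topology B) V" "p \<in> V"
    "smooth_vfield B V (extension B \<xi>)" "extension B \<xi> p = \<xi>"
proof -
  obtain c where c: "c \<in> charts_at B p" using assms(1) points_iff by blast
  have "\<exists>X V. openin (manifold_topology B) V \<and> base \<xi> \<in> V \<and> smooth_vfield B V X \<and> X (base \<xi>) = \<xi>"
    using c assms(2) openin_chart_domain smooth_vfield_constant_in_chart[of c "comp \<xi> c"]
    by (intro exI[of _ "\<lambda>q. tangent_vector c q (comp \<xi> c)"] exI[of _ "cdom c"])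
       (simp add: charts_at_def base_eq tangent_vector_comp)
  from someI_ex[OF this] show ?thesis
    using that base_eq[OF assms(2)] unfolding extension_def by blast
qed

lemma comp_lie_bracket:
  "c \<in> charts_at B p \<Longrightarrow> comp (lie_bracket B X Y p) c =
     fderiv (vfcomp c Y) (cmap c p) (vfcomp c X (cmap c p)) -
     fderiv (vfcomp c X) (cmap c p) (vfcomp c Y (cmap c p))"
  by (simp add: lie_bracket_def tvec_at_def)

text \<open>The derivative of the transformation law \<open>X\<^sub>d (\<tau> z) = D\<tau>(z) (X\<^sub>c z)\<close> for the components
of a vector field in two charts.\<close>

lemma fderiv_vfcomp_transform:
  assumes V: "openin (manifold_topology B) V" "p \<in> V" 
    and X: "\<And>q. q \<in> V \<Longrightarrow> X q \<in> tangent_space B q"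
    and X': "\<And>c. c \<in> charts_at B p \<Longrightarrow> vfcomp c X differentiable (at (cmap c p))"
    and c: "c \<in> charts_at B p" and d: "d \<in> charts_at B p"
  defines "\<tau> \<equiv> cmap d \<circ> cinv c" and "x \<equiv> cmap c p"
  shows "fderiv (vfcomp d X) (cmap d p) (fderiv \<tau> x u)
    = fderiv (\<lambda>z. fderiv \<tau> z (vfcomp c X x)) x u + fderiv \<tau> x (fderiv (vfcomp c X) x u)"
proof -
  let ?N = "cmap c ` (V \<inter> cdom d \<inter> cdom c)"
  have cd: "c \<in> B" "d \<in> B" "p \<in> cdom c" "p \<in> cdom d" using c d by (auto simp: charts_at_def)
  have N: "open ?N" "x \<in> ?N"
    using open_chart_image_Int[OF openin_Int[OF V(1) openin_chart_domain]] cd V(2)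
    by (auto simp: x_def)
  have \<tau>x: "\<tau> x = cmap d p" using cd by (simp add: \<tau>_def x_def cinv_cmap)
  have "?N \<subseteq> cmap c ` (cdom c \<inter> cdom d)" by auto
  then have \<tau>: "smooth_on ?N \<tau>"
    using smooth_transition[OF cd(1,2)] smooth_on_subset \<tau>_def by blast
  have eq: "vfcomp d X (\<tau> z) = fderiv \<tau> z (vfcomp c X z)" if z: "z \<in> ?N" for z
  proof -
    obtain q where q: "z = cmap c q" "q \<in> V" "q \<in> cdom d" "q \<in> cdom c" using z by blast
    then show ?thesis
      using vfcomp_transform[of X, OF X[OF q(2)], of c d] cd
      by (simp add: \<tau>_def cinv_cmap charts_at_def)
  qed
  have "((\<lambda>z. fderiv \<tau> z (vfcomp c X z)) has_derivative (\<lambda>u. fderiv (\<lambda>z. fderiv \<tau> z (vfcomp c X x)) x u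
      + fderiv \<tau> x (fderiv (vfcomp c X) x u))) (at x)"
    using smooth_on_differentiable[OF \<tau>] smooth_on_differentiable[OF smooth_on_fderiv[OF \<tau>]] N
      X'[OF c]
    by (intro has_derivative_linear_family[OF N] linear_fderiv fderiv_works) (auto simp: x_def)
  moreover have "((\<lambda>z. vfcomp d X (\<tau> z)) has_derivative
      (\<lambda>u. fderiv (vfcomp d X) (cmap d p) (fderiv \<tau> x u))) (at x)"
    using has_derivative_compose[of \<tau>, OF fderiv_works[OF smooth_on_differentiable[OF \<tau> N(2)]],
        unfolded \<tau>x, OF fderiv_works[OF X'[OF d]]] .
  then have "((\<lambda>z. fderiv \<tau> z (vfcomp c X z)) has_derivative
      (\<lambda>u. fderiv (vfcomp d X) (cmap d p) (fderiv \<tau> x u))) (at x)"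
    by (rule has_derivative_transform_within_open[OF _ N eq])
  ultimately show ?thesis
    using has_derivative_unique by (metis (no_types, lifting))
qed

text \<open>Tensoriality of the bracket: the second derivatives of the transition map that arise
  in a change of charts cancel by symmetry.\<close>

lemma lie_bracket_in:
  assumes V: "openin (manifold_topology B) V" "p \<in> V"
    and X: "\<And>q. q \<in> V \<Longrightarrow> X q \<in> tangent_space B q"
    and X': "\<And>c. c \<in> charts_at B p \<Longrightarrow> vfcomp c X differentiable (at (cmap c p))"
    and Y: "\<And>q. q \<in> V \<Longrightarrow> Y q \<in> tangent_space B q"
    and Y': "\<And>c. c \<in> charts_at B p \<Longrightarrow> vfcomp c Y differentiable (at (cmap c p))"
  shows "lie_bracket B X Y p \<in> tangent_space B p"
proof (rule tangent_spaceI)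
  fix c d assume c: "c \<in> charts_at B p" and d: "d \<in> charts_at B p"
  define \<tau> x where "\<tau> = cmap d \<circ> cinv c" and "x = cmap c p"
  have sym: "fderiv (\<lambda>z. fderiv \<tau> z v) x w = fderiv (\<lambda>z. fderiv \<tau> z w) x v" for v w
    unfolding \<tau>_def x_def using c d
    by (intro second_derivative_symmetric[OF open_overlap _ smooth_transition])
       (auto simp: charts_at_def)
  show "comp (lie_bracket B X Y p) d
      = fderiv (cmap d \<circ> cinv c) (cmap c p) (comp (lie_bracket B X Y p) c)"
    using fderiv_vfcomp_transform[OF V X X' c d, of "vfcomp c Y x"]
      fderiv_vfcomp_transform[OF V Y Y' c d, of "vfcomp c X x"]
      sym[of "vfcomp c X x" "vfcomp c Y x"]
    unfolding comp_lie_bracket[OF c] comp_lie_bracket[OF d]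
      linear_diff[OF linear_fderiv_transition[OF c d]]
      vfcomp_transform[of X, OF X[OF V(2)] c d]
      vfcomp_transform[of Y, OF Y[OF V(2)] c d] \<tau>_def x_def
    by simp
qed (simp_all add: lie_bracket_def tvec_at_def)

end

section \<open>The tangent bundle\<close>

context atlas
begin

definition tchart :: "('b, 'f) chart \<Rightarrow> (('b, 'f) tvec, 'f \<times> 'f) chart" where
  "tchart c = Chart {v \<in> tangent_bundle B. base v \<in> cdom c} (\<lambda>v. (cmap c (base v), comp v c))"

lemma cdom_tchart: "cdom (tchart c) = {v \<in> tangent_bundle B. base v \<in> cdom c}"
  by (simp add: tchart_def)

lemma cmap_tchart: "cmap (tchart c) v = (cmap c (base v), comp v c)"
  by (simp add: tchart_def)

lemma tangent_atlas_eq: "tangent_atlas B = tchart ` B"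
  by (simp add: tangent_atlas_def tchart_def)

lemma tangent_bundleD:
  assumes "v \<in> tangent_bundle B"
  shows "v \<in> tangent_space B (base v)" "base v \<in> points B"
  using assms base_eq by (auto simp: tangent_bundle_def)

lemma tangent_bundleI: "p \<in> points B \<Longrightarrow> v \<in> tangent_space B p \<Longrightarrow> v \<in> tangent_bundle B"
  by (auto simp: tangent_bundle_def)

lemma tangent_vector_in_bundle: "c \<in> charts_at B p \<Longrightarrow> tangent_vector c p u \<in> tangent_bundle B"
  using tangent_bundleI tangent_vector_in points_iff by blast

lemma inj_on_tchart:
  assumes "c \<in> B"
  shows "inj_on (cmap (tchart c)) (cdom (tchart c))"
proof (rule inj_onI)
  fix v w assume v: "v \<in> cdom (tchart c)" and w: "w \<in> cdom (tchart c)"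
    and eq: "cmap (tchart c) v = cmap (tchart c) w"
  have b: "base v = base w"
    using inj_onD[OF inj_on_cmap[OF assms]] v w eq by (auto simp: cdom_tchart cmap_tchart)
  show "v = w"
    using tangent_space_eqI[OF tangent_bundleD(1) tangent_bundleD(1)[of w, folded b], of c]
      v w eq assms by (auto simp: cdom_tchart cmap_tchart charts_at_def)
qed

lemma cinv_tchart:
  assumes c: "c \<in> B" and p: "p \<in> cdom c"
  shows "cinv (tchart c) (cmap c p, y) = tangent_vector c p y"
proof -
  have cp: "c \<in> charts_at B p" using assms by (simp add: charts_at_def)
  have "tangent_vector c p y \<in> cdom (tchart c)"
    using p by (simp add: cdom_tchart tangent_vector_in_bundle[OF cp] base_tangent_vector)
  then have "cinv (tchart c) (cmap (tchart c) (tangent_vector c p y)) = tangent_vector c p y"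
    using inj_on_tchart[OF c] by (simp add: cinv_def)
  then show ?thesis
    by (simp add: cmap_tchart base_tangent_vector comp_tangent_vector_self[OF cp])
qed

lemma tchart_overlap:
  assumes c: "c \<in> B"
  shows "cmap (tchart c) ` (cdom (tchart c) \<inter> cdom (tchart d)) = (cmap c ` (cdom c \<inter> cdom d)) \<times> UNIV"
    (is "?L = ?R")
proof
  show "?L \<subseteq> ?R" by (auto simp: cdom_tchart cmap_tchart)
  show "?R \<subseteq> ?L"
  proof
    fix z assume "z \<in> ?R"
    then obtain p y where z: "z = (cmap c p, y)" "p \<in> cdom c" "p \<in> cdom d" by auto
    have cp: "c \<in> charts_at B p" using c z by (simp add: charts_at_def)
    have "z = cmap (tchart c) (tangent_vector c p y)"
      by (simp add: z cmap_tchart base_tangent_vector comp_tangent_vector_self[OF cp])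
    then show "z \<in> ?L"
      using z by (auto simp: cdom_tchart base_tangent_vector tangent_vector_in_bundle[OF cp])
  qed
qed

lemma tchart_image: "c \<in> B \<Longrightarrow> cmap (tchart c) ` cdom (tchart c) = (cmap c ` cdom c) \<times> UNIV"
  using tchart_overlap[of c c] by simp

lemma tchart_transition:
  assumes "c \<in> B" "d \<in> B" "z \<in> (cmap c ` (cdom c \<inter> cdom d)) \<times> UNIV"
  shows "(cmap (tchart d) \<circ> cinv (tchart c)) z =
    ((cmap d \<circ> cinv c) (fst z), fderiv (cmap d \<circ> cinv c) (fst z) (snd z))"
  using assms
  by (auto simp: cinv_tchart cmap_tchart base_tangent_vector comp_tangent_vector charts_at_def cinv_cmap)

text \<open>In the charts of the tangent bundle a transition map is \<open>(x, y) \<mapsto> (\<tau> x, D\<tau>(x) y)\<close>; its second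
component is smooth as a smooth family of linear maps applied to a smooth function.\<close>

lemma smooth_atlas_tangent_atlas: "smooth_atlas (tangent_atlas B)"
proof -
  have "smooth_on (cmap (tchart c) ` (cdom (tchart c) \<inter> cdom (tchart d)))
      (cmap (tchart d) \<circ> cinv (tchart c))" if c: "c \<in> B" and d: "d \<in> B" for c d
  proof -
    let ?W = "cmap c ` (cdom c \<inter> cdom d)" and ?\<tau> = "cmap d \<circ> cinv c"
    have W: "open ?W" "open (?W \<times> (UNIV :: 'f set))"
      using open_overlap[OF c d] by (auto intro: open_Times)
    have fst: "smooth_on (?W \<times> (UNIV :: 'f set)) (\<lambda>z. h (fst z))" if "smooth_on ?W h"
      for h :: "'f \<Rightarrow> 'f"
      by (rule smooth_on_compose[OF W(2,1) _ smooth_on_linear[OF W(2) bounded_linear_fst] that]) auto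
    have "smooth_on (?W \<times> UNIV) (\<lambda>z. fderiv ?\<tau> (fst z) (snd z))"
      by (rule smooth_on_linear_family[OF W(2) _ fst[OF smooth_on_fderiv[OF smooth_transition[OF c d]]]
            smooth_on_linear[OF W(2) bounded_linear_snd]])
         (auto intro!: linear_fderiv smooth_on_differentiable[OF smooth_transition[OF c d]])
    with fst[OF smooth_transition[OF c d]]
    have "smooth_on (?W \<times> UNIV) (\<lambda>z. (?\<tau> (fst z), fderiv ?\<tau> (fst z) (snd z)))"
      by (rule smooth_on_Pair[OF W(2)])
    then show ?thesis
      unfolding tchart_overlap[OF c]
      by (subst smooth_on_cong[OF W(2) tchart_transition[OF c d]])
  qed
  moreover have "open (cmap (tchart c) ` (cdom (tchart c) \<inter> cdom (tchart d)))"
    if "c \<in> B" "d \<in> B" for c d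
    unfolding tchart_overlap[OF that(1)] by (intro open_Times open_overlap that open_UNIV)
  moreover have "open (cmap (tchart c) ` cdom (tchart c))" if "c \<in> B" for c
    unfolding tchart_image[OF that] by (intro open_Times open_chart_image that open_UNIV)
  ultimately show ?thesis
    unfolding smooth_atlas_def tangent_atlas_eq using inj_on_tchart by blast
qed

end

locale tangent_bundle_atlas = atlas B
  for B :: "('b, 'f::euclidean_space) chart set"

sublocale tangent_bundle_atlas \<subseteq> T: atlas "tangent_atlas B"
  by (unfold_locales) (rule smooth_atlas_tangent_atlas)

context tangent_bundle_atlas
begin

abbreviation TB :: "(('b, 'f) tvec, 'f \<times> 'f) chart set" where "TB \<equiv> tangent_atlas B"

lemma points_tangent_atlas: "points TB = tangent_bundle B"
  using tangent_bundleD(2) by (auto simp: points_def tangent_atlas_eq cdom_tchart)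

lemma tchart_in: "v \<in> tangent_bundle B \<Longrightarrow> c \<in> charts_at B (base v) \<Longrightarrow> tchart c \<in> charts_at TB v"
  by (auto simp: charts_at_def tangent_atlas_eq cdom_tchart)

lemma charts_at_tangent_atlasE:
  assumes "d \<in> charts_at TB v"
  obtains c where "d = tchart c" "c \<in> charts_at B (base v)"
  using assms by (auto simp: charts_at_def tangent_atlas_eq cdom_tchart)

lemma exists_chart: "v \<in> tangent_bundle B \<Longrightarrow> \<exists>c. c \<in> charts_at B (base v)"
  using tangent_bundleD(2) points_iff by blast

lemma has_derivative_tchart_transition:
  assumes c: "c \<in> charts_at B (base v)" and d: "d \<in> charts_at B (base v)"
  defines "\<tau> \<equiv> cmap d \<circ> cinv c" and "x \<equiv> cmap c (base v)"
  shows "((cmap (tchart d) \<circ> cinv (tchart c)) has_derivative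
    (\<lambda>u. (fderiv \<tau> x (fst u), fderiv (\<lambda>z. fderiv \<tau> z (comp v c)) x (fst u) + fderiv \<tau> x (snd u))))
    (at (cmap (tchart c) v))"
proof -
  let ?W = "cmap c ` (cdom c \<inter> cdom d)"
  let ?y = "comp v c"
  have cd: "c \<in> B" "d \<in> B" "base v \<in> cdom c" "base v \<in> cdom d"
    using c d by (auto simp: charts_at_def)
  have W: "open ?W" "open (?W \<times> (UNIV :: 'f set))" "x \<in> ?W" "(x, ?y) \<in> ?W \<times> UNIV"
    using open_overlap[OF cd(1,2)] cd by (auto intro: open_Times simp: x_def)
  have \<tau>: "smooth_on ?W \<tau>" unfolding \<tau>_def by (rule smooth_transition[OF cd(1,2)])
  have fst: "((\<lambda>z. h (fst z)) has_derivative (\<lambda>u. fderiv h x (fst u))) (at (x, ?y))"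
    if "smooth_on ?W h" for h :: "'f \<Rightarrow> 'f"
    by (rule has_derivative_compose[OF has_derivative_fst[OF has_derivative_ident]])
       (use smooth_on_differentiable[OF that W(3)] in \<open>simp add: fderiv_works\<close>)
  have 1: "((\<lambda>z. fderiv \<tau> (fst z) (snd z)) has_derivative
      (\<lambda>u. fderiv (\<lambda>z. fderiv \<tau> z ?y) x (fst u) + fderiv \<tau> x (snd u))) (at (x, ?y))"
    using has_derivative_linear_family[OF W(2,4), of "\<lambda>z. fderiv \<tau> (fst z)" snd snd]
      linear_fderiv[OF smooth_on_differentiable[OF \<tau>]] differentiableI[OF fst[OF smooth_on_fderiv[OF \<tau>]]]
    by (auto simp: fderiv_eqI[OF fst[OF smooth_on_fderiv[OF \<tau>]]] has_derivative_snd)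
  show ?thesis
    unfolding cmap_tchart[of c v] x_def[symmetric]
    by (rule has_derivative_transform_within_open[OF has_derivative_Pair[OF fst[OF \<tau>] 1] W(2,4)])
       (simp only: tchart_transition[OF cd(1,2)] \<tau>_def)
qed

lemma fst_comp_transform:
  assumes v: "v \<in> tangent_bundle B" and c: "c \<in> charts_at B (base v)" and d: "d \<in> charts_at B (base v)"
    and \<xi>: "\<xi> \<in> tangent_space TB v"
  shows "fst (comp \<xi> (tchart d)) = fderiv (cmap d \<circ> cinv c) (cmap c (base v)) (fst (comp \<xi> (tchart c)))"
  using T.comp_transform[OF \<xi> tchart_in[OF v c] tchart_in[OF v d]]
  by (simp add: fderiv_eqI[OF has_derivative_tchart_transition[OF c d]])

subsection \<open>Vertical lift and vertical endomorphism in induced charts\<close>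

lemma comp_vlift:
  assumes v: "v \<in> tangent_bundle B" and c: "c \<in> charts_at B (base v)"
  shows "comp (vlift B v w) (tchart c) = (0, comp w c)"
proof -
  have v0: "tadd v (tscale 0 w) = v" by (cases v) (simp add: tadd_def tscale_def)
  have "((\<lambda>t. (cmap c (base v), comp v c + t *\<^sub>R comp w c)) has_vector_derivative (0, comp w c)) (at 0)"
    by (auto intro!: derivative_eq_intros simp: has_vector_derivative_def)
  then have "vector_derivative (cmap (tchart c) \<circ> (\<lambda>t. tadd v (tscale t w))) (at 0) = (0, comp w c)"
    by (simp add: o_def cmap_tchart tadd_def tscale_def vector_derivative_at)
  then show ?thesis
    using tchart_in[OF v c] by (simp add: vlift_def velocity_def tvec_at_def v0)
qed

lemma vlift_in:
  assumes v: "v \<in> tangent_bundle B" and w: "w \<in> tangent_space B (base v)"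
  shows "vlift B v w \<in> tangent_space TB v"
proof (rule T.tangent_spaceI)
  have v0: "tadd v (tscale 0 w) = v" by (cases v) (simp add: tadd_def tscale_def)
  show "base (vlift B v w) = v" by (simp add: vlift_def velocity_def tvec_at_def v0)
  show "comp (vlift B v w) c = 0" if "c \<notin> charts_at TB v" for c
    using that by (simp add: vlift_def velocity_def tvec_at_def v0)
  fix c' d' assume "c' \<in> charts_at TB v" "d' \<in> charts_at TB v"
  then obtain c d where cd: "c' = tchart c" "d' = tchart d" "c \<in> charts_at B (base v)" "d \<in> charts_at B (base v)"
    by (meson charts_at_tangent_atlasE)
  have "linear (fderiv (\<lambda>z. fderiv (cmap d \<circ> cinv c) z (comp v c)) (cmap c (base v)))"
    by (rule linear_fderiv, rule smooth_on_differentiable[OF smooth_on_fderiv[OF smooth_transition]])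
       (use cd(3,4) in \<open>auto simp: charts_at_def\<close>)
  then show "comp (vlift B v w) d' = fderiv (cmap d' \<circ> cinv c') (cmap c' v) (comp (vlift B v w) c')"
    using comp_transform[OF w cd(3,4)] linear_0[OF linear_fderiv_transition[OF cd(3,4)]]
    by (simp add: cd(1,2) comp_vlift[OF v] cd(3,4) linear_0
        fderiv_eqI[OF has_derivative_tchart_transition[OF cd(3,4)]])
qed

lemma comp_tangent_map_base:
  assumes v: "v \<in> tangent_bundle B" and c: "c \<in> charts_at B (base v)" and \<xi>: "\<xi> \<in> tangent_space TB v"
  shows "comp (tangent_map TB B base \<xi>) c = fst (comp \<xi> (tchart c))"
proof -
  have cB: "c \<in> B" "base v \<in> cdom c" using c by (auto simp: charts_at_def)
  have "((cmap c \<circ> base) \<circ> cinv (tchart c) has_derivative fst) (at (cmap (tchart c) v))"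
    by (rule has_derivative_transform_within_open[OF has_derivative_fst[OF has_derivative_ident]
          T.open_chart_image[of "tchart c"]])
       (use cB v in \<open>auto simp: tangent_atlas_eq tchart_image[unfolded o_def] cinv_tchart
          base_tangent_vector cmap_tchart[of c v]\<close>)
  then show ?thesis
    using c T.dfun_in_chart[OF \<xi> tchart_in[OF v c], of "cmap c \<circ> base"]
    by (auto simp: tangent_map_def tvec_at_def T.base_eq[OF \<xi>] fderiv_eqI differentiable_def)
qed

lemma tangent_map_base_in:
  assumes v: "v \<in> tangent_bundle B" and \<xi>: "\<xi> \<in> tangent_space TB v"
  shows "tangent_map TB B base \<xi> \<in> tangent_space B (base v)"
proof (rule tangent_spaceI)
  fix c d assume cd: "c \<in> charts_at B (base v)" "d \<in> charts_at B (base v)"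
  show "comp (tangent_map TB B base \<xi>) d
      = fderiv (cmap d \<circ> cinv c) (cmap c (base v)) (comp (tangent_map TB B base \<xi>) c)"
    using fst_comp_transform[OF v cd \<xi>] by (simp only: comp_tangent_map_base[OF v _ \<xi>] cd)
qed (simp_all add: tangent_map_def tvec_at_def T.base_eq[OF \<xi>])

lemma vertical_endo_in:
  "v \<in> tangent_bundle B \<Longrightarrow> \<xi> \<in> tangent_space TB v \<Longrightarrow> vertical_endo B \<xi> \<in> tangent_space TB v"
  unfolding vertical_endo_def by (simp add: T.base_eq vlift_in tangent_map_base_in)

lemma comp_vertical_endo:
  "v \<in> tangent_bundle B \<Longrightarrow> c \<in> charts_at B (base v) \<Longrightarrow> \<xi> \<in> tangent_space TB v \<Longrightarrow>
   comp (vertical_endo B \<xi>) (tchart c) = (0, fst (comp \<xi> (tchart c)))"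
  unfolding vertical_endo_def by (simp add: T.base_eq comp_vlift comp_tangent_map_base)

lemma comp_liouville:
  "v \<in> tangent_bundle B \<Longrightarrow> c \<in> charts_at B (base v) \<Longrightarrow> comp (liouville B v) (tchart c) = (0, comp v c)"
  unfolding liouville_def by (rule comp_vlift)

text \<open>Computed with an extension \<open>X\<close> of \<open>\<xi>\<close>, the two brackets in
  \<open>[J,Y]X = [JX,Y] - J[X,Y]\<close> contain the same derivative of \<open>X\<close> along \<open>Y\<close>. It cancels, and only
  derivatives of \<open>Y\<close> remain.\<close>

lemma comp_bracket_vertical_endo:
  assumes V: "openin (manifold_topology TB) V" "v \<in> V"
    and Y: "\<And>q. q \<in> V \<Longrightarrow> Y q \<in> tangent_space TB q"
    and Y': "\<And>c. c \<in> charts_at TB v \<Longrightarrow> vfcomp c Y differentiable (at (cmap c v))"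
    and \<xi>: "\<xi> \<in> tangent_space TB v" and c: "c \<in> charts_at B (base v)"
  defines "D \<equiv> fderiv (vfcomp (tchart c) Y) (cmap (tchart c) v)"
  shows "comp (vform_bracket TB (vertical_endo B) Y \<xi>) (tchart c)
    = D (0, fst (comp \<xi> (tchart c))) - (0, fst (D (comp \<xi> (tchart c))))"
proof -
  let ?c = "tchart c"
  define z where "z = cmap ?c v"
  have "V \<subseteq> tangent_bundle B" using V(1) by (simp add: T.openin_manifold points_tangent_atlas)
  then have v: "v \<in> tangent_bundle B" using V(2) by blast
  have cv: "?c \<in> charts_at TB v" by (rule tchart_in[OF v c])
  have cT: "?c \<in> TB" "v \<in> cdom ?c" using cv by (auto simp: charts_at_def)
  define X where "X = extension TB \<xi>"
  obtain W where W: "openin (manifold_topology TB) W" "v \<in> W" "smooth_vfield TB W X" "X v = \<xi>"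
    using T.extension[OF _ \<xi>] v points_tangent_atlas unfolding X_def by blast
  let ?V = "V \<inter> W"
  have V': "openin (manifold_topology TB) ?V" "v \<in> ?V" using V W by auto
  have XV: "X q \<in> tangent_space TB q" if "q \<in> ?V" for q
    using T.smooth_vfieldD(1)[OF W(3)] that by auto
  have X': "vfcomp d X differentiable (at (cmap d v))" if "d \<in> charts_at TB v" for d
    using T.smooth_vfieldD(2)[OF W(3,2) that] .
  have Xz: "vfcomp ?c X z = comp \<xi> ?c" using cT by (simp add: vfcomp_def z_def T.cinv_cmap W(4))
  have in_bracket: "lie_bracket TB X Y v \<in> tangent_space TB v"
    using T.lie_bracket_in[OF V' XV X' _ Y'] Y by blast
  let ?N = "cmap ?c ` (?V \<inter> cdom ?c)"
  have N: "open ?N" "z \<in> ?N"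
    using T.open_chart_image_Int[OF V'(1) cT(1)] V' cT(2) by (auto simp: z_def)
  have JX: "vfcomp ?c (\<lambda>q. vertical_endo B (X q)) x = (0, fst (vfcomp ?c X x))" if "x \<in> ?N" for x
  proof -
    obtain q where q: "x = cmap ?c q" "q \<in> ?V" "q \<in> cdom ?c" using \<open>x \<in> ?N\<close> by blast
    then have "q \<in> tangent_bundle B" "c \<in> charts_at B (base q)"
      using c by (auto simp: cdom_tchart charts_at_def)
    from comp_vertical_endo[OF this XV[OF q(2)]] show ?thesis
      using q(1,3) cT(1) by (simp add: vfcomp_def T.cinv_cmap)
  qed
  have "((\<lambda>x. (0, fst (vfcomp ?c X x))) has_derivative (\<lambda>u. (0, fst (fderiv (vfcomp ?c X) z u)))) (at z)"
    using X'[OF cv] by (intro has_derivative_Pair has_derivative_const has_derivative_fst fderiv_works)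
      (simp add: z_def)
  then have "(vfcomp ?c (\<lambda>q. vertical_endo B (X q)) has_derivative
      (\<lambda>u. (0, fst (fderiv (vfcomp ?c X) z u)))) (at z)"
    by (rule has_derivative_transform_within_open[OF _ N JX[symmetric]])
  note DJX = fderiv_eqI[OF this]
  have 1: "comp (lie_bracket TB (\<lambda>q. vertical_endo B (X q)) Y v) ?c
      = D (0, fst (comp \<xi> ?c)) - (0, fst (fderiv (vfcomp ?c X) z (vfcomp ?c Y z)))"
    unfolding T.comp_lie_bracket[OF cv] z_def[symmetric] DJX JX[OF N(2)] Xz D_def by (rule refl)
  have 2: "comp (vertical_endo B (lie_bracket TB X Y v)) ?c
      = (0, fst (D (comp \<xi> ?c)) - fst (fderiv (vfcomp ?c X) z (vfcomp ?c Y z)))"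
    unfolding comp_vertical_endo[OF v c in_bracket] T.comp_lie_bracket[OF cv]
    by (simp add: z_def[symmetric] Xz D_def)
  show ?thesis
    unfolding vform_bracket_def Let_def T.base_eq[OF \<xi>] X_def[symmetric]
    by (simp add: tadd_def tscale_def 1 2)
qed

end

section \<open>Linear systems with differentiable coefficients\<close>

text \<open>Continuity of \<open>a\<close> suffices in the product rule because the term with the increment of \<open>a\<close> has a
factor \<open>f\<close>, which vanishes at \<open>z\<close> to first order.\<close>

lemma has_derivative_scaleR_zero:
  fixes f :: "'z::real_normed_vector \<Rightarrow> 'b::real_normed_vector"
  assumes a: "isCont a z" and f: "(f has_derivative f') (at z)" and f0: "f z = 0"
  shows "((\<lambda>x. a x *\<^sub>R f x) has_derivative (\<lambda>u. a z *\<^sub>R f' u)) (at z)"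
proof -
  have lin: "bounded_linear f'" using f by (rule has_derivative_bounded_linear)
  define q where "q x = norm (f x - f z - f' (x - z)) / norm (x - z)" for x
  have q: "(q \<longlongrightarrow> 0) (at z)" using f unfolding has_derivative_iff_norm q_def by blast
  have bound: "norm (a x *\<^sub>R f x - a z *\<^sub>R f z - a z *\<^sub>R f' (x - z)) / norm (x - z)
      \<le> \<bar>a x\<bar> * q x + \<bar>a x - a z\<bar> * onorm f'" if "x \<noteq> z" for x
  proof -
    have "a x *\<^sub>R f x - a z *\<^sub>R f z - a z *\<^sub>R f' (x - z)
        = a x *\<^sub>R (f x - f z - f' (x - z)) + (a x - a z) *\<^sub>R f' (x - z)"
      by (simp add: f0 algebra_simps)
    then have "norm (a x *\<^sub>R f x - a z *\<^sub>R f z - a z *\<^sub>R f' (x - z))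
        \<le> \<bar>a x\<bar> * norm (f x - f z - f' (x - z)) + \<bar>a x - a z\<bar> * norm (f' (x - z))"
      using norm_triangle_ineq by (metis norm_scaleR)
    also have "\<dots> \<le> \<bar>a x\<bar> * norm (f x - f z - f' (x - z)) + \<bar>a x - a z\<bar> * (onorm f' * norm (x - z))"
      by (intro add_left_mono mult_left_mono onorm[OF lin]) auto
    finally show ?thesis
      using that by (simp add: q_def divide_simps algebra_simps)
  qed
  have "((\<lambda>x. \<bar>a x\<bar> * q x + \<bar>a x - a z\<bar> * onorm f') \<longlongrightarrow> \<bar>a z\<bar> * 0 + \<bar>a z - a z\<bar> * onorm f') (at z)"
    using a unfolding isCont_def by (intro tendsto_intros q)
  then have lim: "((\<lambda>x. \<bar>a x\<bar> * q x + \<bar>a x - a z\<bar> * onorm f') \<longlongrightarrow> 0) (at z)"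
    by simp
  have "eventually (\<lambda>x. norm (norm (a x *\<^sub>R f x - a z *\<^sub>R f z - a z *\<^sub>R f' (x - z)) / norm (x - z))
      \<le> \<bar>a x\<bar> * q x + \<bar>a x - a z\<bar> * onorm f') (at z)"
    by (rule eventually_mono[OF eventually_neq_at_within[of z]],
        simp only: real_norm_def abs_divide abs_norm_cancel, rule bound)
  then have "((\<lambda>x. norm (a x *\<^sub>R f x - a z *\<^sub>R f z - a z *\<^sub>R f' (x - z)) / norm (x - z)) \<longlongrightarrow> 0) (at z)"
    by (rule Lim_null_comparison[OF _ lim])
  then show ?thesis
    unfolding has_derivative_iff_norm
    using bounded_linear_compose[OF bounded_linear_scaleR_right lin] by blast
qed

text \<open>Reduced to \<open>W z = id\<close> by a left inverse, the system reads \<open>s = r + K s\<close> with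
  \<open>K = id - W\<close> vanishing at \<open>z\<close>. Since \<open>K\<close> is small near \<open>z\<close>, this bounds \<open>s\<close>, then shows that
  \<open>s\<close> is continuous, and then that it is differentiable.\<close>

lemma differentiable_linear_system:
  fixes W :: "'z::real_normed_vector \<Rightarrow> 'n::euclidean_space \<Rightarrow> 'n"
  assumes U: "open U" "z \<in> U"
    and lin: "\<And>x. x \<in> U \<Longrightarrow> linear (W x)" and W: "\<And>u. (\<lambda>x. W x u) differentiable (at z)"
    and inj: "\<And>u. W z u = 0 \<Longrightarrow> u = 0"
    and sol: "\<And>x. x \<in> U \<Longrightarrow> W x (s x) = r x" and r: "r differentiable (at z)"
  shows "s differentiable (at z)"
proof -
  obtain G where G: "linear G" "G \<circ> W z = id"
    using linear_injective_left_inverse[OF lin[OF U(2)]] linear_injective_0[OF lin[OF U(2)]] inj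
    by metis
  then have Gb: "bounded_linear G" by (simp add: linear_conv_bounded_linear)
  define K where "K x u = u - G (W x u)" for x u
  define \<rho> where "\<rho> x = G (r x)" for x
  have K: "(\<lambda>x. K x u) differentiable (at z)" for u
    unfolding K_def
    by (rule differentiable_diff[OF differentiable_const
          differentiableI[OF bounded_linear.has_derivative[OF Gb fderiv_works[OF W]]]])
  have K0: "K z u = 0" for u using G(2) by (simp add: K_def fun_eq_iff)
  have \<rho>: "\<rho> differentiable (at z)"
    using bounded_linear.has_derivative[OF Gb fderiv_works[OF r]] unfolding \<rho>_def by (rule differentiableI)
  have expand: "K x u = (\<Sum>i\<in>Basis. (u \<bullet> i) *\<^sub>R K x i)" if "x \<in> U" for x u
  proof (rule linear_basis_expansion)
    show "linear (K x)"
      unfolding K_def by (intro linear_compose_sub linear_ident linear_compose[OF lin[OF that] G(1), unfolded o_def])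
  qed
  have s: "s x = \<rho> x + K x (s x)" if "x \<in> U" for x
    using sol[OF that] by (simp add: K_def \<rho>_def)
  define k where "k x = (\<Sum>i\<in>Basis. norm (K x i))" for x
  have "isCont k z"
    unfolding k_def
    by (intro continuous_intros differentiable_imp_continuous_within K)
  then have k: "(k \<longlongrightarrow> 0) (at z)" by (simp add: isCont_def k_def K0)
  have Kbound: "norm (K x u) \<le> norm u * k x" if "x \<in> U" for x u
    by (subst expand[OF that], unfold k_def sum_distrib_left, rule sum_norm_le)
       (auto intro: mult_right_mono Basis_le_norm)
  have near: "eventually (\<lambda>x. x \<in> U \<and> k x < 1/2) (at z)"
    using eventually_at_topological U order_tendstoD(2)[OF k, of "1/2"]
    by (auto intro!: eventually_conj)
  have \<rho>lim: "(\<rho> \<longlongrightarrow> \<rho> z) (at z)"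
    using differentiable_imp_continuous_within[OF \<rho>] by (simp add: isCont_def)
  have "eventually (\<lambda>x. norm (s x - \<rho> x) \<le> 2 * norm (\<rho> x) * k x) (at z)"
    using near
  proof eventually_elim
    case (elim x)
    have "k x \<ge> 0" unfolding k_def by (simp add: sum_nonneg)
    have "norm (s x) \<le> norm (\<rho> x) + norm (s x) * k x"
      using s[of x] norm_triangle_ineq[of "\<rho> x" "K x (s x)"] Kbound[of x "s x"] elim by simp
    moreover have "norm (s x) * k x \<le> norm (s x) * (1/2)"
      using elim by (intro mult_left_mono) auto
    ultimately have "norm (s x) \<le> 2 * norm (\<rho> x)" by simp
    then have "norm (K x (s x)) \<le> 2 * norm (\<rho> x) * k x"
      using Kbound[of x "s x"] elim mult_right_mono[OF _ \<open>k x \<ge> 0\<close>] by fastforce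
    moreover have "s x - \<rho> x = K x (s x)" using s[of x] elim by (simp add: algebra_simps)
    ultimately show ?case by simp
  qed
  then have "((\<lambda>x. s x - \<rho> x) \<longlongrightarrow> 0) (at z)"
  proof (rule Lim_null_comparison)
    show "((\<lambda>x. 2 * norm (\<rho> x) * k x) \<longlongrightarrow> 0) (at z)"
      using tendsto_mult[OF tendsto_mult[OF tendsto_const tendsto_norm[OF \<rho>lim]] k] by simp
  qed
  then have "(s \<longlongrightarrow> \<rho> z) (at z)"
    using tendsto_add[OF _ \<rho>lim, of "\<lambda>x. s x - \<rho> x" 0] by simp
  moreover have "s z = \<rho> z" using s[OF U(2)] K0 by simp
  ultimately have cont: "isCont s z" by (simp add: isCont_def)
  have "((\<lambda>x. \<rho> x + (\<Sum>i\<in>Basis. (s x \<bullet> i) *\<^sub>R K x i)) has_derivative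
      (\<lambda>u. fderiv \<rho> z u + (\<Sum>i\<in>Basis. (s z \<bullet> i) *\<^sub>R fderiv (\<lambda>x. K x i) z u))) (at z)"
    using cont
    by (intro has_derivative_add has_derivative_sum has_derivative_scaleR_zero fderiv_works K \<rho> K0
        continuous_intros)
  then have "(s has_derivative
      (\<lambda>u. fderiv \<rho> z u + (\<Sum>i\<in>Basis. (s z \<bullet> i) *\<^sub>R fderiv (\<lambda>x. K x i) z u))) (at z)"
    by (rule has_derivative_transform_within_open[OF _ U]) (metis s expand)
  then show ?thesis by (rule differentiableI)
qed

section \<open>The fundamental form in coordinates\<close>

text \<open>Coordinates are \<open>z = (x, y)\<close>, and \<open>e\<close> is the energy in them. The Hessian below has one
  argument in all of \<open>TTM\<close> and one, given by its fibre component, that is vertical. These are the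
  only second derivatives of the energy that occur in \<open>d d\<^sub>J E\<close>.\<close>

definition vhess :: "('e::euclidean_space \<times> 'e \<Rightarrow> real) \<Rightarrow> 'e \<times> 'e \<Rightarrow> 'e \<times> 'e \<Rightarrow> 'e \<Rightarrow> real" where
  "vhess e z w a = fderiv (\<lambda>z. fderiv e z (0, a)) z w"

definition energy_form :: "('e::euclidean_space \<times> 'e \<Rightarrow> real) \<Rightarrow> 'e \<times> 'e \<Rightarrow> 'e \<times> 'e \<Rightarrow> 'e \<times> 'e \<Rightarrow> real" where
  "energy_form e z \<xi> \<eta> = vhess e z \<xi> (fst \<eta>) - vhess e z \<eta> (fst \<xi>)"

locale coordinate_energy =
  fixes Q :: "('e::euclidean_space \<times> 'e) set" and e :: "'e \<times> 'e \<Rightarrow> real"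
  assumes open_domain: "open Q" and smooth: "smooth_on Q e"
    and euler: "\<And>z. z \<in> Q \<Longrightarrow> fderiv e z (0, snd z) = 2 * e z"
    and nondegenerate: "\<And>z \<xi>. z \<in> Q \<Longrightarrow> (\<And>\<eta>. energy_form e z \<xi> \<eta> = 0) \<Longrightarrow> \<xi> = 0"
begin

lemma e_differentiable: "z \<in> Q \<Longrightarrow> e differentiable (at z)"
  using smooth smooth_on_differentiable by blast

lemma de_differentiable: "z \<in> Q \<Longrightarrow> (\<lambda>z. fderiv e z w) differentiable (at z)"
  using smooth_on_fderiv[OF smooth] smooth_on_differentiable by blast

lemma linear_de: "z \<in> Q \<Longrightarrow> linear (fderiv e z)"
  by (rule linear_fderiv[OF e_differentiable])

lemma linear_de_vertical: "z \<in> Q \<Longrightarrow> linear (\<lambda>a. fderiv e z (0, a))"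
  using linear_compose[OF _ linear_de, of "\<lambda>a. (0, a)" z]
  by (simp add: o_def bounded_linear.linear bounded_linear_Pair)

lemma vhess_sym: "z \<in> Q \<Longrightarrow> fderiv (\<lambda>z. fderiv e z w) z (0, a) = vhess e z w a"
  unfolding vhess_def by (rule second_derivative_symmetric[OF open_domain _ smooth])

lemma linear_vhess1: "z \<in> Q \<Longrightarrow> linear (\<lambda>w. vhess e z w a)"
  unfolding vhess_def by (rule linear_fderiv[OF de_differentiable])

lemma linear_vhess2: "z \<in> Q \<Longrightarrow> linear (vhess e z w)"
  using linear_compose[OF _ linear_fderiv[OF de_differentiable], of "\<lambda>a. (0, a)" z w]
  by (simp add: o_def vhess_sym bounded_linear.linear bounded_linear_Pair)

lemma vhess_vertical_sym: "z \<in> Q \<Longrightarrow> vhess e z (0, b) a = vhess e z (0, a) b"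
  using vhess_sym[of z "(0, b)" a] by (simp add: vhess_def)

lemma vhess_differentiable: "z \<in> Q \<Longrightarrow> (\<lambda>z. vhess e z w a) differentiable (at z)"
  unfolding vhess_def using smooth_on_fderiv[OF smooth_on_fderiv[OF smooth]]
  by (rule smooth_on_differentiable)

lemma energy_form_differentiable: "z \<in> Q \<Longrightarrow> (\<lambda>z. energy_form e z \<xi> \<eta>) differentiable (at z)"
  unfolding energy_form_def by (intro differentiable_diff vhess_differentiable)

lemma linear_energy_form1: "z \<in> Q \<Longrightarrow> linear (\<lambda>\<xi>. energy_form e z \<xi> \<eta>)"
  unfolding energy_form_def
  by (intro linear_compose_sub linear_vhess1
      linear_compose[OF linear_fst linear_vhess2, unfolded o_def])

lemma linear_energy_form2: "z \<in> Q \<Longrightarrow> linear (energy_form e z \<xi>)"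
  unfolding energy_form_def
  by (intro linear_compose_sub linear_vhess1
      linear_compose[OF linear_fst linear_vhess2, unfolded o_def])

lemma energy_form_vertical: "z \<in> Q \<Longrightarrow> energy_form e z (0, u) (a, b) = vhess e z (0, u) a"
  using linear_0[OF linear_vhess2] by (simp add: energy_form_def)

text \<open>A vector \<open>u\<close> in the kernel of the vertical Hessian gives a vertical vector \<open>(0, u)\<close> in the kernel of
the fundamental form.\<close>

lemma vhess_nondegenerate:
  assumes z: "z \<in> Q" and "\<And>b. vhess e z (0, b) u = 0"
  shows "u = 0"
  using nondegenerate[OF z, of "(0, u)"] assms vhess_vertical_sym[OF z]
  by (auto simp: energy_form_vertical[OF z] zero_prod_def)

text \<open>For vertical \<open>w\<close> this is \<open>E\<^sub>y\<^sub>y(y, \<cdot>) = E\<^sub>y\<close>, the form in which homogeneity mostly enters.\<close>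

lemma euler_derivative:
  assumes z: "z \<in> Q"
  shows "vhess e z w (snd z) + fderiv e z (0, snd w) = 2 * fderiv e z w"
proof -
  have "((\<lambda>z. fderiv e z (0, snd z)) has_derivative
      (\<lambda>u. fderiv (\<lambda>x. fderiv e x (0, snd z)) z u + fderiv e z (0, snd u))) (at z)"
    using z by (intro has_derivative_linear_family[OF open_domain z] linear_de de_differentiable
        has_derivative_Pair has_derivative_const has_derivative_snd has_derivative_ident)
  then have 1: "((\<lambda>z. 2 * e z) has_derivative
      (\<lambda>u. fderiv (\<lambda>x. fderiv e x (0, snd z)) z u + fderiv e z (0, snd u))) (at z)"
    by (rule has_derivative_transform_within_open[OF _ open_domain z euler])
  have 2: "((\<lambda>z. 2 * e z) has_derivative (\<lambda>u. 2 * fderiv e z u)) (at z)"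
    by (intro has_derivative_mult_right fderiv_works e_differentiable z)
  show ?thesis
    unfolding vhess_def by (rule fun_cong[OF has_derivative_unique[OF 1 2]])
qed

definition energy_matrix :: "'e \<times> 'e \<Rightarrow> 'e \<times> 'e \<Rightarrow> 'e \<times> 'e" where
  "energy_matrix z \<xi> = (\<Sum>i\<in>Basis. energy_form e z \<xi> i *\<^sub>R i)"

lemma linear_energy_matrix: "z \<in> Q \<Longrightarrow> linear (energy_matrix z)"
  unfolding energy_matrix_def
  by (intro linear_compose_sum ballI)
     (rule linear_compose[OF linear_energy_form1 linear_scaleR_left, unfolded o_def])

lemma linear_eq_inner:
  fixes b :: "'e \<times> 'e \<Rightarrow> real"
  assumes "linear b"
  shows "b \<eta> = \<eta> \<bullet> (\<Sum>i\<in>Basis. b i *\<^sub>R i)"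
  by (subst linear_basis_expansion[OF assms]) (simp add: inner_sum_right mult.commute)

lemma energy_form_eq_inner: "z \<in> Q \<Longrightarrow> energy_form e z \<xi> \<eta> = \<eta> \<bullet> energy_matrix z \<xi>"
  unfolding energy_matrix_def by (rule linear_eq_inner[OF linear_energy_form2])

lemma energy_matrix_inj: "z \<in> Q \<Longrightarrow> energy_matrix z \<xi> = 0 \<Longrightarrow> \<xi> = 0"
  using nondegenerate energy_form_eq_inner by (metis inner_zero_right)

lemma energy_form_solvable:
  assumes z: "z \<in> Q" and b: "linear b"
  shows "\<exists>\<xi>. \<forall>\<eta>. energy_form e z \<xi> \<eta> = b \<eta>"
proof -
  have "inj (energy_matrix z)"
    using linear_injective_0[OF linear_energy_matrix[OF z]] energy_matrix_inj[OF z] by blast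
  then have "surj (energy_matrix z)"
    by (rule linear_inj_imp_surj[OF linear_energy_matrix[OF z]])
  then obtain \<xi> where \<xi>: "energy_matrix z \<xi> = (\<Sum>i\<in>Basis. b i *\<^sub>R i)" by (metis surjD)
  have "energy_form e z \<xi> \<eta> = b \<eta>" for \<eta>
    unfolding energy_form_eq_inner[OF z] \<xi> by (rule linear_eq_inner[OF b, symmetric])
  then show ?thesis by blast
qed

text \<open>The solution depends differentiably on the point because it solves a linear system with
differentiable coefficients.\<close>

lemma energy_form_solution_differentiable:
  assumes z: "z \<in> Q" and Z: "\<And>x \<eta>. x \<in> Q \<Longrightarrow> energy_form e x (Z x) \<eta> = b x \<eta>"
    and b: "\<And>\<eta>. (\<lambda>x. b x \<eta>) differentiable (at z)"
  shows "Z differentiable (at z)"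
proof (rule differentiable_linear_system[OF open_domain z linear_energy_matrix])
  show "(\<lambda>x. energy_matrix x u) differentiable (at z)" for u
    unfolding energy_matrix_def
    by (intro differentiable_sum differentiable_scaleR energy_form_differentiable z
        differentiable_const finite_Basis ballI)
  show "energy_matrix x (Z x) = (\<Sum>i\<in>Basis. b x i *\<^sub>R i)" if "x \<in> Q" for x
    using that by (simp add: energy_matrix_def Z)
  show "(\<lambda>x. \<Sum>i\<in>Basis. b x i *\<^sub>R i) differentiable (at z)"
    by (intro differentiable_sum differentiable_scaleR b differentiable_const finite_Basis ballI)
qed (use energy_matrix_inj[OF z] in auto)

text \<open>Evaluation on vertical vectors \<open>(0, b)\<close> leaves only the vertical Hessian, and the derivative of
  Euler's relation identifies \<open>-y\<close> as the solution. For \<open>\<xi> = (dE)\<^sup># = -S\<^sub>0\<close> this says that the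
  canonical spray is a semispray.\<close>

lemma fst_sharp_energy:
  assumes z: "z \<in> Q" and Z: "\<And>\<eta>. energy_form e z \<xi> \<eta> = fderiv e z \<eta>"
  shows "fst \<xi> = - snd z"
proof -
  have "vhess e z (0, b) (fst \<xi> + snd z) = 0" for b
    using Z[of "(0, b)"] euler_derivative[OF z, of "(0, b)"] linear_0[OF linear_vhess2[OF z]]
    by (simp add: energy_form_def linear_add[OF linear_vhess2[OF z]])
  then show ?thesis using vhess_nondegenerate[OF z] by (metis add_eq_0_iff2)
qed

lemma fst_fderiv_sharp_energy:
  assumes z: "z \<in> Q" and Z: "\<And>x \<eta>. x \<in> Q \<Longrightarrow> energy_form e x (Z x) \<eta> = fderiv e x \<eta>"
    and Zd: "Z differentiable (at z)"
  shows "fst (fderiv Z z w) = - snd w"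
proof -
  have 1: "((\<lambda>x. - snd x) has_derivative (\<lambda>w. fst (fderiv Z z w))) (at z)"
    by (rule has_derivative_transform_within_open[OF has_derivative_fst[OF fderiv_works[OF Zd]]
          open_domain z]) (rule fst_sharp_energy[OF _ Z])
  have 2: "((\<lambda>x. - snd x) has_derivative (\<lambda>w. - snd w)) (at z)"
    by (intro has_derivative_minus has_derivative_snd has_derivative_ident)
  show ?thesis by (rule fun_cong[OF has_derivative_unique[OF 1 2]])
qed

text \<open>The energy is constant along the canonical spray, since \<open>dE(S\<^sub>0) = -\<omega>(S\<^sub>0, S\<^sub>0) = 0\<close>. The
  vertical derivative of this identity, simplified by Euler's relation, is the coordinate form of
  the conservativity of the Berwald connection. Here \<open>Z = -S\<^sub>0\<close>.\<close>

lemma berwald_conservative_coordinates: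
  assumes z: "z \<in> Q" and Z: "\<And>x \<eta>. x \<in> Q \<Longrightarrow> energy_form e x (Z x) \<eta> = fderiv e x \<eta>"
  shows "2 * fderiv e z (a, 0) = fderiv e z (0, snd (fderiv Z z (0, a)))"
proof -
  have Zd: "Z differentiable (at z)"
    by (rule energy_form_solution_differentiable[OF z Z de_differentiable[OF z]])
  note DZ = fst_fderiv_sharp_energy[OF z Z Zd]
  have "((\<lambda>x. fderiv e x (Z x)) has_derivative
      (\<lambda>u. fderiv (\<lambda>x. fderiv e x (Z z)) z u + fderiv e z (fderiv Z z u))) (at z)"
    by (intro has_derivative_linear_family[OF open_domain z] linear_de de_differentiable z
        fderiv_works Zd)
  moreover have "fderiv e x (Z x) = 0" if "x \<in> Q" for x
    using Z[OF that, of "Z x"] by (simp add: energy_form_def)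
  ultimately have "((\<lambda>x. 0) has_derivative
      (\<lambda>u. fderiv (\<lambda>x. fderiv e x (Z z)) z u + fderiv e z (fderiv Z z u))) (at z)"
    by (rule has_derivative_transform_within_open[OF _ open_domain z])
  from fun_cong[OF has_derivative_unique[OF this has_derivative_const]]
  have "fderiv (\<lambda>x. fderiv e x (Z z)) z (0, a) + fderiv e z (fderiv Z z (0, a)) = 0" .
  then have "vhess e z (Z z) a + fderiv e z (- a, snd (fderiv Z z (0, a))) = 0"
    using DZ[of "(0, a)"] by (simp add: vhess_sym[OF z]) (metis prod.collapse snd_conv)
  moreover have "fderiv e z (- a, b) = fderiv e z (0, b) - fderiv e z (a, 0)" for b
    using linear_diff[OF linear_de[OF z], of "(0, b)" "(a, 0)"] by simp
  moreover have "vhess e z (Z z) a + 2 * fderiv e z (a, 0) = fderiv e z (a, 0)"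
    using Z[OF z, of "(a, 0)"] fst_sharp_energy[OF z Z[OF z]] euler_derivative[OF z, of "(a, 0)"]
      linear_0[OF linear_de[OF z]] linear_neg[OF linear_vhess2[OF z]]
    by (simp add: energy_form_def zero_prod_def)
  ultimately show ?thesis by simp
qed

text \<open>For \<open>L = (0, l)\<close> in coordinates, \<open>d\<^sub>LE\<close> vanishes on vertical vectors, hence so does the pairing of
  the vertical Hessian with the base component of \<open>(d\<^sub>LE)\<^sup>#\<close>.\<close>

lemma sharp_semibasic_vertical:
  assumes z: "z \<in> Q" and Z: "\<And>\<eta>. energy_form e z \<xi> \<eta> = fderiv e z (0, l (fst \<eta>))" and l: "linear l"
  shows "fst \<xi> = 0"
proof (rule vhess_nondegenerate[OF z])
  show "vhess e z (0, b) (fst \<xi>) = 0" for b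
    using Z[of "(0, b)"] linear_0[OF linear_vhess2[OF z]] linear_0[OF l] linear_0[OF linear_de[OF z]]
    by (simp add: energy_form_def zero_prod_def)
qed

text \<open>Here \<open>Z = (0, s)\<close> is the coordinate form of \<open>(d\<^sub>LE)\<^sup>#\<close>, and the function differentiated is that of
\<open>L\<^sup>\<circ>E\<close>. The derivative of Euler's relation in direction \<open>Z\<close> shows that this function equals
\<open>E\<^sub>y(s)\<close>. Differentiating the latter in direction \<open>(0, a)\<close> produces \<open>E\<^sub>y\<^sub>y(a, s) = E\<^sub>y(l a)\<close>, by
symmetry of the Hessian and the equation for \<open>Z\<close>, and a term with the derivative of \<open>s\<close>.\<close>

lemma derivative_along_potential:
  assumes z: "z \<in> Q"
    and l: "\<And>x. x \<in> Q \<Longrightarrow> linear (l x)"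
    and Z: "\<And>x \<eta>. x \<in> Q \<Longrightarrow> energy_form e x (Z x) \<eta> = fderiv e x (0, l x (fst \<eta>))"
    and Zd: "Z differentiable (at z)"
  shows "((\<lambda>x. fderiv e x (0, l x (snd x))) has_derivative
      (\<lambda>u. fderiv (\<lambda>x. fderiv e x (0, snd (Z z))) z u + fderiv e z (0, snd (fderiv Z z u)))) (at z)"
    and "fderiv (\<lambda>x. fderiv e x (0, l x (snd x))) z (0, a)
      = fderiv e z (0, l z a) + fderiv e z (0, snd (fderiv Z z (0, a)))"
proof -
  have vert: "Z x = (0, snd (Z x))" if "x \<in> Q" for x
    using sharp_semibasic_vertical[OF that Z l] that by (metis prod.collapse)
  have eq: "fderiv e x (0, snd (Z x)) = fderiv e x (0, l x (snd x))" if x: "x \<in> Q" for x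
  proof -
    have "fderiv e x (0, l x (snd x)) = vhess e x (0, snd (Z x)) (snd x)"
      using Z[OF x, of "(snd x, 0)"] vert[OF x] energy_form_vertical[OF x] by (metis fst_conv)
    then show ?thesis using euler_derivative[OF x, of "(0, snd (Z x))"] by simp
  qed
  have "((\<lambda>x. fderiv e x (0, snd (Z x))) has_derivative
      (\<lambda>u. fderiv (\<lambda>x. fderiv e x (0, snd (Z z))) z u + fderiv e z (0, snd (fderiv Z z u)))) (at z)"
    by (intro has_derivative_linear_family[OF open_domain z] linear_de de_differentiable z
        fderiv_works Zd has_derivative_Pair has_derivative_const has_derivative_snd)
  then show der: "((\<lambda>x. fderiv e x (0, l x (snd x))) has_derivative
      (\<lambda>u. fderiv (\<lambda>x. fderiv e x (0, snd (Z z))) z u + fderiv e z (0, snd (fderiv Z z u)))) (at z)"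
    by (rule has_derivative_transform_within_open[OF _ open_domain z eq])
  have "fderiv (\<lambda>x. fderiv e x (0, snd (Z z))) z (0, a) = vhess e z (0, snd (Z z)) a"
    by (rule vhess_sym[OF z])
  also have "\<dots> = fderiv e z (0, l z a)"
    using Z[OF z, of "(a, 0)"] vert[OF z] energy_form_vertical[OF z] by (metis fst_conv)
  finally show "fderiv (\<lambda>x. fderiv e x (0, l x (snd x))) z (0, a)
      = fderiv e z (0, l z a) + fderiv e z (0, snd (fderiv Z z (0, a)))"
    by (simp add: fderiv_eqI[OF der])
qed

end

section \<open>Finsler manifolds\<close>

locale finsler = tangent_bundle_atlas A
  for A :: "('a, 'e::euclidean_space) chart set" +
  fixes E :: "('a, 'e) tvec \<Rightarrow> real"
  assumes finsler_energy: "finsler_energy A E"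
begin

definition nonzero_domain :: "('a, 'e) chart \<Rightarrow> ('e \<times> 'e) set" where
  "nonzero_domain c = (cmap c ` cdom c) \<times> (UNIV - {0})"

abbreviation energy_in :: "('a, 'e) chart \<Rightarrow> 'e \<times> 'e \<Rightarrow> real" where
  "energy_in c \<equiv> E \<circ> cinv (tchart c)"

lemma nonzero_in_bundle: "v \<in> nonzero_tangent A \<Longrightarrow> v \<in> tangent_bundle A"
  by (simp add: nonzero_tangent_def)

lemma nonzero_iff:
  assumes v: "v \<in> tangent_bundle A" and c: "c \<in> charts_at A (base v)"
  shows "v \<in> nonzero_tangent A \<longleftrightarrow> comp v c \<noteq> 0"
proof -
  have "comp (tzero p) c = (0 :: 'e)" for p :: 'a by (simp add: tzero_def)
  then have "v = tzero (base v) \<longleftrightarrow> comp v c = 0"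
    using tangent_space_eqI[OF tangent_bundleD(1)[OF v] tzero_in c] by metis
  then show ?thesis using v by (simp add: nonzero_tangent_def)
qed

lemma tchart_image_nonzero:
  assumes c: "c \<in> A"
  shows "cmap (tchart c) ` (nonzero_tangent A \<inter> cdom (tchart c)) = nonzero_domain c" (is "?L = ?R")
proof
  show "?L \<subseteq> ?R"
    using c nonzero_iff by (auto simp: nonzero_domain_def cdom_tchart cmap_tchart charts_at_def)
  show "?R \<subseteq> ?L"
  proof
    fix z assume "z \<in> ?R"
    then have z: "z \<in> cmap (tchart c) ` cdom (tchart c)" "snd z \<noteq> 0"
      unfolding tchart_image[OF c] by (auto simp: nonzero_domain_def)
    then obtain v where v: "z = cmap (tchart c) v" "v \<in> cdom (tchart c)" by blast
    then have "v \<in> nonzero_tangent A"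
      using nonzero_iff[of v c] z(2) c by (auto simp: cdom_tchart cmap_tchart charts_at_def)
    then show "z \<in> ?L" using v by blast
  qed
qed

lemma open_nonzero_domain: "c \<in> A \<Longrightarrow> open (nonzero_domain c)"
  unfolding nonzero_domain_def by (intro open_Times open_chart_image open_Diff open_UNIV closed_singleton)

lemma openin_nonzero: "openin (manifold_topology TB) (nonzero_tangent A)"
  unfolding T.openin_manifold points_tangent_atlas unfolding tangent_atlas_eq
  using open_nonzero_domain tchart_image_nonzero nonzero_in_bundle by auto

lemma coordinates_in_nonzero_domain:
  assumes "v \<in> nonzero_tangent A" "c \<in> charts_at A (base v)"
  shows "cmap (tchart c) v \<in> nonzero_domain c"
  using assms nonzero_iff[OF nonzero_in_bundle[OF assms(1)] assms(2)]
  by (simp add: nonzero_domain_def cmap_tchart charts_at_def)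

lemma nonzero_domainE:
  assumes c: "c \<in> A" and z: "z \<in> nonzero_domain c"
  obtains v where "v \<in> nonzero_tangent A" "c \<in> charts_at A (base v)" "z = cmap (tchart c) v"
    "cinv (tchart c) z = v"
proof -
  obtain v where v: "v \<in> nonzero_tangent A" "v \<in> cdom (tchart c)" "z = cmap (tchart c) v"
    using z unfolding tchart_image_nonzero[OF c, symmetric] by blast
  moreover have "c \<in> charts_at A (base v)" using v(2) c by (simp add: charts_at_def cdom_tchart)
  moreover have "cinv (tchart c) z = v"
    unfolding v(3) by (rule T.cinv_cmap) (use c v(2) in \<open>auto simp: tangent_atlas_eq\<close>)
  ultimately show ?thesis using that by blast
qed

lemma cinv_coordinates:
  assumes "v \<in> tangent_bundle A" "c \<in> charts_at A (base v)"
  shows "cinv (tchart c) (cmap (tchart c) v) = v"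
  using tchart_in[OF assms] T.cinv_cmap by (simp add: charts_at_def)

lemma smooth_energy_in:
  assumes c: "c \<in> A"
  shows "smooth_on (nonzero_domain c) (energy_in c)"
proof -
  have "tchart c \<in> TB" using c by (simp add: tangent_atlas_eq)
  moreover have "smooth_fun TB (nonzero_tangent A) E"
    using finsler_energy unfolding finsler_energy_def by blast
  ultimately show ?thesis
    unfolding smooth_fun_def Ck_fun_def smooth_on_def tchart_image_nonzero[OF c, symmetric] by blast
qed

lemma C1_energy_in:
  assumes c: "c \<in> A"
  shows "Ck_on 1 ((cmap c ` cdom c) \<times> UNIV) (energy_in c)"
proof -
  have "tchart c \<in> TB" using c by (simp add: tangent_atlas_eq)
  moreover have "tangent_bundle A \<inter> cdom (tchart c) = cdom (tchart c)" by (auto simp: cdom_tchart)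
  moreover have "Ck_fun TB 1 (tangent_bundle A) E"
    using finsler_energy unfolding finsler_energy_def by blast
  ultimately show ?thesis
    unfolding Ck_fun_def using tchart_image[OF c] by metis
qed

lemma coordinates_in_image:
  "c \<in> charts_at A (base v) \<Longrightarrow> cmap (tchart c) v \<in> (cmap c ` cdom c) \<times> UNIV"
  by (simp add: cmap_tchart charts_at_def)

lemma energy_in_differentiable:
  assumes "c \<in> A" "z \<in> (cmap c ` cdom c) \<times> UNIV"
  shows "energy_in c differentiable (at z)"
  using C1_energy_in[OF assms(1)] assms(2) unfolding One_nat_def by (rule Ck_on_differentiable)

lemma dfun_energy:
  assumes v: "v \<in> tangent_bundle A" and \<xi>: "\<xi> \<in> tangent_space TB v" and c: "c \<in> charts_at A (base v)"
  shows "dfun TB E \<xi> = fderiv (energy_in c) (cmap (tchart c) v) (comp \<xi> (tchart c))"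
  by (rule T.dfun_in_chart[OF \<xi> tchart_in[OF v c]
        energy_in_differentiable[OF charts_atD(1)[OF c] coordinates_in_image[OF c]]])

lemma euler_in_chart:
  assumes c: "c \<in> A" and z: "z \<in> nonzero_domain c"
  shows "fderiv (energy_in c) z (0, snd z) = 2 * energy_in c z"
proof -
  obtain v where v: "v \<in> nonzero_tangent A" "c \<in> charts_at A (base v)" "z = cmap (tchart c) v"
    using nonzero_domainE[OF c z] by blast
  let ?p = "base v" and ?y = "comp v c"
  have vT: "v \<in> tangent_space A ?p" "v \<in> tangent_bundle A"
    using nonzero_in_bundle[OF v(1)] tangent_bundleD by auto
  have hom: "energy_in c (cmap c ?p, r *\<^sub>R ?y) = r\<^sup>2 * E v" if "r > 0" for r
  proof -
    have "cinv (tchart c) (cmap c ?p, r *\<^sub>R ?y) = tscale r v"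
    proof (rule tangent_space_eqI)
      show "cinv (tchart c) (cmap c ?p, r *\<^sub>R ?y) \<in> tangent_space A ?p"
        using v(2) charts_atD by (simp add: cinv_tchart tangent_vector_in)
      show "comp (cinv (tchart c) (cmap c ?p, r *\<^sub>R ?y)) c = comp (tscale r v) c"
        using v(2) charts_atD by (simp add: cinv_tchart comp_tangent_vector_self tscale_def)
    qed (use tscale_in[OF vT(1)] v(2) in auto)
    then show ?thesis
      using finsler_energy vT(2) that by (simp add: finsler_energy_def)
  qed
  have line: "(cmap c ?p, 0) + r *\<^sub>R (0, ?y) = (cmap c ?p, r *\<^sub>R ?y)" for r by simp
  have z': "(cmap c ?p, 0) + 1 *\<^sub>R (0, ?y) = z" by (simp add: v(3) cmap_tchart)
  have 1: "((\<lambda>r. energy_in c ((cmap c ?p, 0) + r *\<^sub>R (0, ?y))) has_real_derivative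
      fderiv (energy_in c) z (0, ?y)) (at 1)"
    by (rule has_real_derivative_along_line[of "energy_in c" "(cmap c ?p, 0)" 1 "(0, ?y)", unfolded z',
          OF energy_in_differentiable[OF c coordinates_in_image[OF v(2), folded v(3)]]])
  have 2: "((\<lambda>r. energy_in c ((cmap c ?p, 0) + r *\<^sub>R (0, ?y))) has_real_derivative 2 * E v) (at 1)"
  proof (rule has_field_derivative_transform_within_open)
    show "((\<lambda>r. r\<^sup>2 * E v) has_real_derivative 2 * E v) (at 1)"
      by (auto intro!: derivative_eq_intros)
    show "r\<^sup>2 * E v = energy_in c ((cmap c ?p, 0) + r *\<^sub>R (0, ?y))" if "r \<in> {0<..}" for r
      unfolding line using hom[of r] that by simp
  qed auto
  show ?thesis
    using DERIV_unique[OF 1 2] cinv_coordinates[OF vT(2) v(2)] by (simp add: v(3) cmap_tchart[of c v])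
qed

text \<open>The derivatives of the extensions \<open>X\<close> and \<open>Y\<close> that come from \<open>X(\<beta>(Y)) - Y(\<beta>(X))\<close> are those in
  \<open>\<beta>([X,Y])\<close>, so that only second derivatives of the energy remain.\<close>

lemma fundamental_form_in_chart:
  assumes v: "v \<in> nonzero_tangent A" and \<xi>: "\<xi> \<in> tangent_space TB v" and \<eta>: "\<eta> \<in> tangent_space TB v"
    and c: "c \<in> charts_at A (base v)"
  shows "fundamental_form A E \<xi> \<eta>
    = energy_form (energy_in c) (cmap (tchart c) v) (comp \<xi> (tchart c)) (comp \<eta> (tchart c))"
proof -
  let ?c = "tchart c" and ?e = "energy_in c"
  let ?\<beta> = "d_along TB (vertical_endo A) E"
  define z where "z = cmap ?c v"
  have vB: "v \<in> tangent_bundle A" by (rule nonzero_in_bundle[OF v])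
  have cA: "c \<in> A" by (rule charts_atD(1)[OF c])
  have cv: "?c \<in> charts_at TB v" by (rule tchart_in[OF vB c])
  have cT: "?c \<in> TB" "v \<in> cdom ?c" using cv by (auto simp: charts_at_def)
  have zQ: "z \<in> nonzero_domain c"
    unfolding z_def by (rule coordinates_in_nonzero_domain[OF v c])
  have \<beta>: "?\<beta> \<zeta> = fderiv ?e (cmap ?c w) (0, fst (comp \<zeta> ?c))"
    if "w \<in> tangent_bundle A" "c \<in> charts_at A (base w)" "\<zeta> \<in> tangent_space TB w" for w \<zeta>
    using dfun_energy[OF that(1) vertical_endo_in[OF that(1,3)] that(2)]
    by (simp add: d_along_def comp_vertical_endo[OF that])
  have lin: "linear (fderiv ?e x)" if "x \<in> nonzero_domain c" for x
    using smooth_on_differentiable[OF smooth_energy_in[OF cA] that] by (rule linear_fderiv)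
  have diff: "(\<lambda>x. fderiv ?e x w) differentiable (at z)" for w
    using smooth_on_differentiable[OF smooth_on_fderiv[OF smooth_energy_in[OF cA]] zQ] .
  have along: "dfun TB (\<lambda>q. ?\<beta> (Y q)) \<xi>
      = vhess ?e z (comp \<xi> ?c) (fst (comp \<eta> ?c))
        + fderiv ?e z (0, fst (fderiv (vfcomp ?c Y) z (comp \<xi> ?c)))"
    if V: "openin (manifold_topology TB) V" "v \<in> V" "smooth_vfield TB V Y" and Yv: "Y v = \<eta>"
      and \<xi>: "\<xi> \<in> tangent_space TB v"
    for V Y \<xi> \<eta>
  proof -
    let ?V = "V \<inter> nonzero_tangent A"
    let ?N = "cmap ?c ` (?V \<inter> cdom ?c)"
    have N: "open ?N" "z \<in> ?N"
      using T.open_chart_image_Int[OF openin_Int[OF V(1) openin_nonzero] cT(1)] V(2) v cT(2)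
      by (auto simp: z_def)
    have sub: "x \<in> nonzero_domain c" if "x \<in> ?N" for x
      using that unfolding tchart_image_nonzero[OF cA, symmetric] by blast
    have Yd: "vfcomp ?c Y differentiable (at z)"
      unfolding z_def by (rule T.smooth_vfieldD(2)[OF V(3,2) cv])
    have Yz: "vfcomp ?c Y z = comp \<eta> ?c" by (simp add: vfcomp_def z_def T.cinv_cmap cT Yv)
    have eq: "fderiv ?e x (0, fst (vfcomp ?c Y x)) = ((\<lambda>q. ?\<beta> (Y q)) \<circ> cinv ?c) x" if "x \<in> ?N" for x
    proof -
      obtain q where q: "x = cmap ?c q" "q \<in> V" "q \<in> cdom ?c" using \<open>x \<in> ?N\<close> by blast
      have "?\<beta> (Y q) = fderiv ?e (cmap ?c q) (0, fst (comp (Y q) ?c))"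
        using q cA T.smooth_vfieldD(1)[OF V(3) q(2)]
        by (intro \<beta>) (auto simp: cdom_tchart charts_at_def)
      then show ?thesis using q cT(1) by (simp add: vfcomp_def T.cinv_cmap)
    qed
    have "((\<lambda>x. fderiv ?e x (0, fst (vfcomp ?c Y x))) has_derivative
        (\<lambda>u. fderiv (\<lambda>x. fderiv ?e x (0, fst (vfcomp ?c Y z))) z u
          + fderiv ?e z (0, fst (fderiv (vfcomp ?c Y) z u)))) (at z)"
      by (intro has_derivative_linear_family[OF N] lin sub diff has_derivative_Pair
          has_derivative_const has_derivative_fst fderiv_works Yd)
    then have der: "((\<lambda>q. ?\<beta> (Y q)) \<circ> cinv ?c has_derivative
        (\<lambda>u. fderiv (\<lambda>x. fderiv ?e x (0, fst (vfcomp ?c Y z))) z u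
          + fderiv ?e z (0, fst (fderiv (vfcomp ?c Y) z u)))) (at z)"
      by (rule has_derivative_transform_within_open[OF _ N eq])
    show ?thesis
      using T.dfun_in_chart[OF \<xi> cv, of "\<lambda>q. ?\<beta> (Y q)"] differentiableI[OF der]
      by (simp add: fderiv_eqI[OF der] z_def[symmetric] vhess_def Yz)
  qed
  define X Y where "X = extension TB \<xi>" and "Y = extension TB \<eta>"
  obtain V where V: "openin (manifold_topology TB) V" "v \<in> V" "smooth_vfield TB V X" "X v = \<xi>"
    using T.extension[OF _ \<xi>] vB points_tangent_atlas unfolding X_def by blast
  obtain W where W: "openin (manifold_topology TB) W" "v \<in> W" "smooth_vfield TB W Y" "Y v = \<eta>"
    using T.extension[OF _ \<eta>] vB points_tangent_atlas unfolding Y_def by blast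
  have bracket: "lie_bracket TB X Y v \<in> tangent_space TB v"
    using T.smooth_vfieldD[OF V(3)] T.smooth_vfieldD[OF W(3)] V(2) W(2)
    by (intro T.lie_bracket_in[OF openin_Int[OF V(1) W(1)]]) auto
  have "?\<beta> (lie_bracket TB X Y v)
      = fderiv ?e z (0, fst (fderiv (vfcomp ?c Y) z (comp \<xi> ?c)) - fst (fderiv (vfcomp ?c X) z (comp \<eta> ?c)))"
    unfolding \<beta>[OF vB c bracket] T.comp_lie_bracket[OF cv]
    by (simp add: z_def vfcomp_def[of _ X] vfcomp_def[of _ Y] T.cinv_cmap cT V(4) W(4))
  also have "\<dots> = fderiv ?e z (0, fst (fderiv (vfcomp ?c Y) z (comp \<xi> ?c)))
      - fderiv ?e z (0, fst (fderiv (vfcomp ?c X) z (comp \<eta> ?c)))"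
    by (simp flip: linear_diff[OF lin[OF zQ]])
  finally show ?thesis
    unfolding fundamental_form_def ext_deriv_def Let_def T.base_eq[OF \<xi>]
      X_def[symmetric] Y_def[symmetric] along[OF V \<eta>] along[OF W \<xi>] energy_form_def z_def[symmetric]
    by simp
qed

lemma coordinate_energy:
  assumes c: "c \<in> A"
  shows "coordinate_energy (nonzero_domain c) (energy_in c)"
proof
  show "open (nonzero_domain c)" "smooth_on (nonzero_domain c) (energy_in c)"
    by (rule open_nonzero_domain[OF c] smooth_energy_in[OF c])+
  show "fderiv (energy_in c) z (0, snd z) = 2 * energy_in c z" if "z \<in> nonzero_domain c" for z
    by (rule euler_in_chart[OF c that])
  fix z \<xi> assume z: "z \<in> nonzero_domain c" and zero: "\<And>\<eta>. energy_form (energy_in c) z \<xi> \<eta> = 0"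
  obtain v where v: "v \<in> nonzero_tangent A" "c \<in> charts_at A (base v)" "z = cmap (tchart c) v"
    using nonzero_domainE[OF c z] by blast
  have cv: "tchart c \<in> charts_at TB v" by (rule tchart_in[OF nonzero_in_bundle[OF v(1)] v(2)])
  let ?\<xi> = "T.tangent_vector (tchart c) v \<xi>"
  have \<xi>: "?\<xi> \<in> tangent_space TB v" by (rule T.tangent_vector_in[OF cv])
  have "fundamental_form A E ?\<xi> \<eta> = 0" if "\<eta> \<in> tangent_space TB v" for \<eta>
    unfolding fundamental_form_in_chart[OF v(1) \<xi> that v(2)] T.comp_tangent_vector_self[OF cv]
    using zero v(3) by simp
  moreover have "nondegenerate_at TB (fundamental_form A E) v"
    using finsler_energy v(1) by (simp add: finsler_energy_def)
  ultimately have "?\<xi> = tzero v" using \<xi> unfolding nondegenerate_at_def by blast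
  then show "\<xi> = 0" using T.comp_tangent_vector_self[OF cv, of \<xi>] by (simp add: tzero_def)
qed

text \<open>In coordinates the defining equation of the sharp operator is a linear system whose matrix is
invertible by nondegeneracy of the fundamental form.\<close>

lemma finsler_sharp:
  assumes v: "v \<in> nonzero_tangent A" and c: "c \<in> charts_at A (base v)" and b: "linear b"
    and \<beta>: "\<And>\<eta>. \<eta> \<in> tangent_space TB v \<Longrightarrow> \<beta> \<eta> = b (comp \<eta> (tchart c))"
  shows "finsler_sharp A E \<beta> v \<in> tangent_space TB v"
    and "energy_form (energy_in c) (cmap (tchart c) v) (comp (finsler_sharp A E \<beta> v) (tchart c)) w = b w"
proof -
  interpret coordinate_energy "nonzero_domain c" "energy_in c"
    by (rule coordinate_energy[OF charts_atD(1)[OF c]])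
  let ?z = "cmap (tchart c) v"
  let ?P = "\<lambda>\<xi>. \<xi> \<in> tangent_space TB v \<and> (\<forall>\<eta>\<in>tangent_space TB v. fundamental_form A E \<xi> \<eta> = \<beta> \<eta>)"
  have z: "?z \<in> nonzero_domain c" by (rule coordinates_in_nonzero_domain[OF v c])
  have cv: "tchart c \<in> charts_at TB v" by (rule tchart_in[OF nonzero_in_bundle[OF v] c])
  have P_iff: "?P \<xi> \<longleftrightarrow> \<xi> \<in> tangent_space TB v \<and>
      (\<forall>w. energy_form (energy_in c) ?z (comp \<xi> (tchart c)) w = b w)" for \<xi>
    using fundamental_form_in_chart[OF v _ _ c] \<beta> T.tangent_vector_in[OF cv]
      T.comp_tangent_vector_self[OF cv] by metis
  obtain \<xi>0 where "\<forall>w. energy_form (energy_in c) ?z \<xi>0 w = b w"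
    using energy_form_solvable[OF z b] by blast
  then have "?P (T.tangent_vector (tchart c) v \<xi>0)"
    unfolding P_iff by (simp add: T.tangent_vector_in[OF cv] T.comp_tangent_vector_self[OF cv])
  moreover have "\<xi> = \<xi>'" if "?P \<xi>" "?P \<xi>'" for \<xi> \<xi>'
  proof -
    have "energy_form (energy_in c) ?z (comp \<xi> (tchart c) - comp \<xi>' (tchart c)) w = 0" for w
      using that[unfolded P_iff, THEN conjunct2, THEN spec[of _ w]]
      by (simp only: linear_diff[OF linear_energy_form1[OF z]] diff_self)
    then have "comp \<xi> (tchart c) = comp \<xi>' (tchart c)" using nondegenerate[OF z] by fastforce
    then show ?thesis using T.tangent_space_eqI[OF _ _ cv] that by blast
  qed
  ultimately have "\<exists>!\<xi>. ?P \<xi>" by blast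
  then have "?P (finsler_sharp A E \<beta> v)"
    unfolding finsler_sharp_def sharp_def by (rule theI')
  then show "finsler_sharp A E \<beta> v \<in> tangent_space TB v"
    and "energy_form (energy_in c) ?z (comp (finsler_sharp A E \<beta> v) (tchart c)) w = b w"
    unfolding P_iff by blast+
qed

lemma vfcomp_finsler_sharp:
  assumes c: "c \<in> A" and z: "z \<in> nonzero_domain c"
    and b: "\<And>x. x \<in> nonzero_domain c \<Longrightarrow> linear (b x)"
    and \<beta>: "\<And>v \<eta>. \<lbrakk>v \<in> nonzero_tangent A; c \<in> charts_at A (base v); \<eta> \<in> tangent_space TB v\<rbrakk>
      \<Longrightarrow> \<beta> \<eta> = b (cmap (tchart c) v) (comp \<eta> (tchart c))"
  shows "energy_form (energy_in c) z (vfcomp (tchart c) (finsler_sharp A E \<beta>) z) w = b z w"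
proof -
  obtain v where v: "v \<in> nonzero_tangent A" "c \<in> charts_at A (base v)" "z = cmap (tchart c) v"
    "cinv (tchart c) z = v"
    using nonzero_domainE[OF c z] by blast
  show ?thesis
    using finsler_sharp(2)[OF v(1,2) b[OF z], of \<beta> w] \<beta>[OF v(1,2)] v(3,4)
    by (simp add: vfcomp_def)
qed

subsection \<open>The Berwald connection\<close>

abbreviation dE_sharp :: "(('a, 'e) tvec, 'e \<times> 'e) vfield" where
  "dE_sharp \<equiv> finsler_sharp A E (dfun TB E)"

lemma vfcomp_dE_sharp:
  assumes c: "c \<in> A" and z: "z \<in> nonzero_domain c"
  shows "energy_form (energy_in c) z (vfcomp (tchart c) dE_sharp z) w = fderiv (energy_in c) z w"
proof (rule vfcomp_finsler_sharp[OF c z])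
  show "linear (fderiv (energy_in c) x)" if "x \<in> nonzero_domain c" for x
    by (rule coordinate_energy.linear_de[OF coordinate_energy[OF c] that])
qed (rule dfun_energy[OF nonzero_in_bundle])

lemma dE_sharp_in: 
  assumes v: "v \<in> nonzero_tangent A"
  shows "dE_sharp v \<in> tangent_space TB v"
proof -
  obtain c where c: "c \<in> charts_at A (base v)" using exists_chart[OF nonzero_in_bundle[OF v]] by blast
  show ?thesis
    by (rule finsler_sharp(1)[OF v c
          coordinate_energy.linear_de[OF coordinate_energy coordinates_in_nonzero_domain[OF v c]]
          dfun_energy[OF nonzero_in_bundle[OF v] _ c]])
       (use charts_atD(1)[OF c] in auto)
qed

lemma canonical_spray_in:
  "v \<in> nonzero_tangent A \<Longrightarrow> canonical_spray A E v \<in> tangent_space TB v"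
  by (simp add: canonical_spray_def T.tscale_in dE_sharp_in)

lemma canonical_spray_differentiable:
  assumes c: "c \<in> A" and z: "z \<in> nonzero_domain c"
  shows "(vfcomp (tchart c) (canonical_spray A E) has_derivative
    (\<lambda>w. - fderiv (vfcomp (tchart c) dE_sharp) z w)) (at z)"
proof -
  interpret coordinate_energy "nonzero_domain c" "energy_in c" by (rule coordinate_energy[OF c])
  have d: "vfcomp (tchart c) dE_sharp differentiable (at z)"
    by (rule energy_form_solution_differentiable[OF z vfcomp_dE_sharp[OF c] de_differentiable[OF z]])
  show ?thesis
  proof (rule has_derivative_transform_within_open[OF has_derivative_minus[OF fderiv_works[OF d]]
        open_domain z])
    fix x assume "x \<in> nonzero_domain c"
    then show "- vfcomp (tchart c) dE_sharp x = vfcomp (tchart c) (canonical_spray A E) x"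
      by (rule nonzero_domainE[OF c]) (simp add: vfcomp_def canonical_spray_def tscale_def)
  qed
qed

text \<open>As the base component of \<open>S\<^sub>0\<close> is \<open>y\<close>, the bracket \<open>[J,S\<^sub>0]\<close> maps \<open>(a, b)\<close> to \<open>(a, D\<^sub>y\<sigma> a - b)\<close>, where \<open>\<sigma>\<close>
is the fibre component of \<open>S\<^sub>0\<close>; the argument \<open>b\<close> drops out of the connection.\<close>

lemma berwald_connection_in_chart:
  assumes v: "v \<in> nonzero_tangent A" and \<xi>: "\<xi> \<in> tangent_space TB v" and c: "c \<in> charts_at A (base v)"
  shows "fderiv (energy_in c) (cmap (tchart c) v) (comp (berwald_connection A E \<xi>) (tchart c)) = 0"
proof -
  let ?z = "cmap (tchart c) v" and ?c = "tchart c"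
  have cA: "c \<in> A" by (rule charts_atD(1)[OF c])
  interpret coordinate_energy "nonzero_domain c" "energy_in c" by (rule coordinate_energy[OF cA])
  have z: "?z \<in> nonzero_domain c" by (rule coordinates_in_nonzero_domain[OF v c])
  define D where "D = fderiv (vfcomp ?c dE_sharp) ?z"
  have Zd: "vfcomp ?c dE_sharp differentiable (at ?z)"
    by (rule energy_form_solution_differentiable[OF z vfcomp_dE_sharp[OF cA] de_differentiable[OF z]])
  have fstD: "fst (D w) = - snd w" for w
    unfolding D_def by (rule fst_fderiv_sharp_energy[OF z vfcomp_dE_sharp[OF cA] Zd])
  have diff: "vfcomp d (canonical_spray A E) differentiable (at (cmap d v))"
    if "d \<in> charts_at TB v" for d
    using that
  proof (rule charts_at_tangent_atlasE)
    fix c assume "d = tchart c" "c \<in> charts_at A (base v)"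
    then show ?thesis
      using canonical_spray_differentiable[OF charts_atD(1) coordinates_in_nonzero_domain[OF v]]
      by (auto intro: differentiableI)
  qed
  obtain a b where ab: "comp \<xi> ?c = (a, b)" by fastforce
  have "comp (vform_bracket TB (vertical_endo A) (canonical_spray A E) \<xi>) ?c
      = - D (0, a) - (0, fst (- D (a, b)))"
    using comp_bracket_vertical_endo[OF openin_nonzero v canonical_spray_in diff \<xi> c]
    by (simp add: fderiv_eqI[OF canonical_spray_differentiable[OF cA z]] D_def[symmetric] ab)
  also have "\<dots> = (a, - snd (D (0, a)) - b)"
    using fstD[of "(0, a)"] fstD[of "(a, b)"] by (simp add: prod_eq_iff)
  finally have "comp (berwald_connection A E \<xi>) ?c = (1/2) *\<^sub>R ((a, b) + (a, - snd (D (0, a)) - b))"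
    by (simp only: berwald_connection_def tscale_def tadd_def tvec.sel ab)
  also have "\<dots> = (a, 0) - (1/2) *\<^sub>R (0, snd (D (0, a)))"
    by (simp add: prod_eq_iff flip: scaleR_2)
  finally have "comp (berwald_connection A E \<xi>) ?c = (a, 0) - (1/2) *\<^sub>R (0, snd (D (0, a)))" .
  then show ?thesis
    using berwald_conservative_coordinates[OF z vfcomp_dE_sharp[OF cA], of a]
    by (simp add: linear_diff[OF linear_de[OF z]] linear_cmul[OF linear_de[OF z]] D_def
        del: diff_Pair scaleR_Pair)
qed

end

section \<open>Semibasic vector one-forms and their potential\<close>

locale finsler_semibasic = finsler A E
  for A :: "('a, 'e::euclidean_space) chart set" and E :: "('a, 'e) tvec \<Rightarrow> real" +
  fixes L :: "(('a, 'e) tvec, 'e \<times> 'e) vform" and S :: "(('a, 'e) tvec, 'e \<times> 'e) vfield"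
  assumes smooth_L: "smooth_vform (tangent_atlas A) (tangent_bundle A) L"
    and semibasic_L: "semibasic A L"
    and semispray_S: "semispray A S"
begin

lemma L_in: "v \<in> tangent_bundle A \<Longrightarrow> \<xi> \<in> tangent_space TB v \<Longrightarrow> L \<xi> \<in> tangent_space TB v"
  using smooth_L unfolding smooth_vform_def by blast

lemma L_tadd:
  "v \<in> tangent_bundle A \<Longrightarrow> \<xi> \<in> tangent_space TB v \<Longrightarrow> \<eta> \<in> tangent_space TB v \<Longrightarrow>
   L (tadd \<xi> \<eta>) = tadd (L \<xi>) (L \<eta>)"
  using smooth_L unfolding smooth_vform_def by blast

lemma L_tscale:
  "v \<in> tangent_bundle A \<Longrightarrow> \<xi> \<in> tangent_space TB v \<Longrightarrow> L (tscale r \<xi>) = tscale r (L \<xi>)"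
  using smooth_L unfolding smooth_vform_def by blast

text \<open>The linear map \<open>l\<close> with \<open>L(a, b) = (0, l a)\<close> in the chart \<open>c\<close>, as a function of the point.\<close>

definition L_matrix :: "('a, 'e) chart \<Rightarrow> 'e \<times> 'e \<Rightarrow> 'e \<Rightarrow> 'e" where
  "L_matrix c z a = snd (vfcomp (tchart c) (\<lambda>q. L (T.tangent_vector (tchart c) q (a, 0))) z)"

text \<open>The base component vanishes because of \<open>J \<circ> L = 0\<close>. As every vertical vector is in the image of \<open>J\<close>,
\<open>L \<circ> J = 0\<close> removes the dependence on the fibre component.\<close>

lemma comp_L:
  assumes v: "v \<in> tangent_bundle A" and \<xi>: "\<xi> \<in> tangent_space TB v" and c: "c \<in> charts_at A (base v)"
  shows "comp (L \<xi>) (tchart c) = (0, L_matrix c (cmap (tchart c) v) (fst (comp \<xi> (tchart c))))"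
proof -
  let ?c = "tchart c"
  let ?t = "T.tangent_vector ?c v"
  have cv: "?c \<in> charts_at TB v" by (rule tchart_in[OF v c])
  obtain a b where ab: "comp \<xi> ?c = (a, b)" by fastforce
  have t: "?t u \<in> tangent_space TB v" for u by (rule T.tangent_vector_in[OF cv])
  have tc: "comp (?t u) ?c = u" for u by (rule T.comp_tangent_vector_self[OF cv])
  have "vertical_endo A (L \<xi>) = tzero v"
    using semibasic_L v \<xi> unfolding semibasic_def by blast
  then have fst0: "fst (comp (L \<xi>) ?c) = 0"
    using comp_vertical_endo[OF v c L_in[OF v \<xi>]] by (simp add: tzero_def zero_prod_def)
  have vert: "?t (0, b) = vertical_endo A (?t (b, 0))"
    by (rule T.tangent_space_eqI[OF t vertical_endo_in[OF v t] cv])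
       (simp add: tc comp_vertical_endo[OF v c t])
  have L0: "L (?t (0, b)) = tzero v"
    unfolding vert using semibasic_L v t unfolding semibasic_def by blast
  have "\<xi> = tadd (?t (a, 0)) (?t (0, b))"
    by (rule T.tangent_space_eqI[OF \<xi> T.tadd_in[OF t t] cv]) (simp add: tadd_def tc ab)
  then have "L \<xi> = tadd (L (?t (a, 0))) (tzero v)"
    using L_tadd[OF v t t] L0 by metis
  then have "comp (L \<xi>) ?c = comp (L (?t (a, 0))) ?c" by (simp add: tadd_def tzero_def)
  then show ?thesis
    using fst0 by (simp add: L_matrix_def vfcomp_def cinv_coordinates[OF v c] ab prod_eq_iff)
qed

lemma bundle_coordinatesE:
  assumes c: "c \<in> A" and z: "z \<in> (cmap c ` cdom c) \<times> UNIV"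
  obtains v where "v \<in> tangent_bundle A" "c \<in> charts_at A (base v)" "z = cmap (tchart c) v"
    "cinv (tchart c) z = v"
proof -
  obtain v where v: "v \<in> cdom (tchart c)" "z = cmap (tchart c) v"
    using z unfolding tchart_image[OF c, symmetric] by blast
  then have "v \<in> tangent_bundle A" "c \<in> charts_at A (base v)"
    using c by (auto simp: charts_at_def cdom_tchart)
  then show ?thesis using that v(2) cinv_coordinates by metis
qed

lemma linear_L_matrix:
  assumes c: "c \<in> A" and z: "z \<in> (cmap c ` cdom c) \<times> UNIV"
  shows "linear (L_matrix c z)"
proof (rule bundle_coordinatesE[OF c z])
  fix v assume v: "v \<in> tangent_bundle A" "c \<in> charts_at A (base v)" "z = cmap (tchart c) v"
    "cinv (tchart c) z = v"
  let ?c = "tchart c"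
  let ?t = "\<lambda>a. T.tangent_vector ?c v (a, 0)"
  have cv: "?c \<in> charts_at TB v" by (rule tchart_in[OF v(1,2)])
  have t: "?t u \<in> tangent_space TB v" for u by (rule T.tangent_vector_in[OF cv])
  have tc: "comp (?t u) ?c = (u, 0)" for u by (rule T.comp_tangent_vector_self[OF cv])
  have m: "L_matrix c z a = snd (comp (L (?t a)) ?c)" for a
    by (simp add: L_matrix_def vfcomp_def v(4))
  have "?t (a + b) = tadd (?t a) (?t b)" for a b
    by (rule T.tangent_space_eqI[OF t T.tadd_in[OF t t] cv]) (simp add: tadd_def tc)
  then have add: "L (?t (a + b)) = tadd (L (?t a)) (L (?t b))" for a b
    using L_tadd[OF v(1) t t] by simp
  have "?t (r *\<^sub>R a) = tscale r (?t a)" for r a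
    by (rule T.tangent_space_eqI[OF t T.tscale_in[OF t] cv]) (simp add: tscale_def tc)
  then have scale: "L (?t (r *\<^sub>R a)) = tscale r (L (?t a))" for r a
    using L_tscale[OF v(1) t] by simp
  show ?thesis
    by (rule linearI) (simp_all add: m add scale tadd_def tscale_def)
qed

lemma smooth_L_matrix:
  assumes c: "c \<in> A"
  shows "smooth_on ((cmap c ` cdom c) \<times> UNIV) (\<lambda>z. L_matrix c z a)"
proof -
  let ?c = "tchart c"
  have cT: "?c \<in> TB" using c by (simp add: tangent_atlas_eq)
  have "smooth_vfield TB (cdom ?c) (\<lambda>q. L (T.tangent_vector ?c q (a, 0)))"
    using smooth_L T.openin_chart_domain[OF cT] T.smooth_vfield_constant_in_chart[OF cT]
    unfolding smooth_vform_def by (simp add: cdom_tchart)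
  then have "smooth_on (cmap ?c ` cdom ?c) (vfcomp ?c (\<lambda>q. L (T.tangent_vector ?c q (a, 0))))"
    using cT unfolding smooth_vfield_def Ck_vfield_def smooth_on_def by (metis inf.idem)
  then show ?thesis
    unfolding L_matrix_def tchart_image[OF c, symmetric]
    by (intro smooth_on_bounded_linear[OF T.open_chart_image[OF cT] bounded_linear_snd])
qed

lemma fst_comp_semispray:
  assumes v: "v \<in> tangent_bundle A" and c: "c \<in> charts_at A (base v)"
  shows "S v \<in> tangent_space TB v" and "fst (comp (S v) (tchart c)) = comp v c"
proof -
  show S: "S v \<in> tangent_space TB v"
    using semispray_S v unfolding semispray_def Ck_vfield_def by blast
  have "vertical_endo A (S v) = liouville A v"
    using semispray_S v unfolding semispray_def by blast
  then show "fst (comp (S v) (tchart c)) = comp v c"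
    using comp_vertical_endo[OF v c S] comp_liouville[OF v c] by simp
qed

definition potential_energy :: "('a, 'e) tvec \<Rightarrow> real" where
  "potential_energy v = dfun TB E (potential L S v)"

definition potential_energy_in :: "('a, 'e) chart \<Rightarrow> 'e \<times> 'e \<Rightarrow> real" where
  "potential_energy_in c z = fderiv (energy_in c) z (0, L_matrix c z (snd z))"

lemma dfun_energy_L:
  assumes v: "v \<in> tangent_bundle A" and c: "c \<in> charts_at A (base v)" and \<xi>: "\<xi> \<in> tangent_space TB v"
  shows "dfun TB E (L \<xi>) = fderiv (energy_in c) (cmap (tchart c) v)
    (0, L_matrix c (cmap (tchart c) v) (fst (comp \<xi> (tchart c))))"
  using dfun_energy[OF v L_in[OF v \<xi>] c] comp_L[OF v \<xi> c] by simp

lemma potential_energy_eq: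
  assumes v: "v \<in> tangent_bundle A" and c: "c \<in> charts_at A (base v)"
  shows "potential_energy v = potential_energy_in c (cmap (tchart c) v)"
  using dfun_energy_L[OF assms fst_comp_semispray(1)[OF assms]] fst_comp_semispray(2)[OF assms]
  by (simp add: potential_energy_def potential_def potential_energy_in_def cmap_tchart[of c v])

lemma potential_energy_in_eq:
  "c \<in> A \<Longrightarrow> z \<in> (cmap c ` cdom c) \<times> UNIV \<Longrightarrow>
   (potential_energy \<circ> cinv (tchart c)) z = potential_energy_in c z"
  by (rule bundle_coordinatesE) (auto simp: potential_energy_eq)

text \<open>The domain includes the zero section, where the energy is of class \<open>C\<^sup>1\<close> and \<open>L\<close> is smooth.\<close>

lemma continuous_potential_energy_in:
  assumes c: "c \<in> A"
  shows "continuous_on ((cmap c ` cdom c) \<times> UNIV) (potential_energy_in c)"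
proof -
  let ?U = "(cmap c ` cdom c) \<times> (UNIV :: 'e set)"
  have dE: "continuous_on ?U (\<lambda>z. fderiv (energy_in c) z w)" for w
    using C1_energy_in[OF c] unfolding One_nat_def Ck_on.simps by blast
  have L: "continuous_on ?U (\<lambda>z. L_matrix c z (snd z))"
    by (rule continuous_on_linear_family[OF linear_L_matrix[OF c]
          smooth_on_continuous_on[OF smooth_L_matrix[OF c]] continuous_on_snd[OF continuous_on_id]])
  show ?thesis
    unfolding potential_energy_in_def
    by (rule continuous_on_linear_family[where F = "fderiv (energy_in c)",
          OF linear_fderiv[OF energy_in_differentiable[OF c]] dE
            continuous_on_Pair[OF continuous_on_const L]])
qed

abbreviation dLE_sharp :: "(('a, 'e) tvec, 'e \<times> 'e) vfield" where
  "dLE_sharp \<equiv> finsler_sharp A E (d_along TB L E)"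

lemma linear_dLE:
  assumes c: "c \<in> A" and z: "z \<in> nonzero_domain c"
  shows "linear (\<lambda>w. fderiv (energy_in c) z (0, L_matrix c z (fst w)))"
proof -
  have "linear (L_matrix c z)" using z by (intro linear_L_matrix[OF c]) (auto simp: nonzero_domain_def)
  then show ?thesis
    using linear_compose[OF linear_compose[OF linear_fst]
        coordinate_energy.linear_de_vertical[OF coordinate_energy[OF c] z]]
    by (simp add: o_def)
qed

lemma vfcomp_dLE_sharp:
  assumes c: "c \<in> A" and z: "z \<in> nonzero_domain c"
  shows "energy_form (energy_in c) z (vfcomp (tchart c) dLE_sharp z) w
    = fderiv (energy_in c) z (0, L_matrix c z (fst w))"
  by (rule vfcomp_finsler_sharp[OF c z linear_dLE[OF c]])
     (auto simp: d_along_def dfun_energy_L[OF nonzero_in_bundle])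

lemma dLE_sharp_in:
  assumes v: "v \<in> nonzero_tangent A"
  shows "dLE_sharp v \<in> tangent_space TB v"
proof -
  obtain c where c: "c \<in> charts_at A (base v)" using exists_chart[OF nonzero_in_bundle[OF v]] by blast
  show ?thesis
    by (rule finsler_sharp(1)[OF v c linear_dLE[OF charts_atD(1)[OF c] coordinates_in_nonzero_domain[OF v c]]])
       (simp add: d_along_def dfun_energy_L[OF nonzero_in_bundle[OF v] c])
qed

lemma dLE_sharp_differentiable:
  assumes c: "c \<in> A" and z: "z \<in> nonzero_domain c"
  shows "vfcomp (tchart c) dLE_sharp differentiable (at z)"
proof -
  interpret coordinate_energy "nonzero_domain c" "energy_in c" by (rule coordinate_energy[OF c])
  have sub: "nonzero_domain c \<subseteq> (cmap c ` cdom c) \<times> UNIV" by (auto simp: nonzero_domain_def)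
  have "(\<lambda>x. fderiv (energy_in c) x (0, L_matrix c x a)) differentiable (at z)" for a
  proof (rule differentiableI)
    show "((\<lambda>x. fderiv (energy_in c) x (0, L_matrix c x a)) has_derivative
      (\<lambda>u. fderiv (\<lambda>x. fderiv (energy_in c) x (0, L_matrix c z a)) z u
        + fderiv (energy_in c) z (0, fderiv (\<lambda>x. L_matrix c x a) z u))) (at z)"
      using smooth_on_differentiable[OF smooth_L_matrix[OF c]] sub z
      by (intro has_derivative_linear_family[OF open_domain z] linear_de de_differentiable z
          has_derivative_Pair has_derivative_const fderiv_works) auto
  qed
  then show ?thesis
    using energy_form_solution_differentiable[OF z vfcomp_dLE_sharp[OF c]] by blast
qed

lemma potential_energy_differentiable:
  assumes c: "c \<in> A" and z: "z \<in> nonzero_domain c"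
  shows "(potential_energy \<circ> cinv (tchart c)) differentiable (at z)"
    and "fderiv (potential_energy \<circ> cinv (tchart c)) z (0, a)
      = fderiv (energy_in c) z (0, L_matrix c z a)
        + fderiv (energy_in c) z (0, snd (fderiv (vfcomp (tchart c) dLE_sharp) z (0, a)))"
proof -
  interpret coordinate_energy "nonzero_domain c" "energy_in c" by (rule coordinate_energy[OF c])
  have eq: "(potential_energy \<circ> cinv (tchart c)) x = fderiv (energy_in c) x (0, L_matrix c x (snd x))"
    if "x \<in> nonzero_domain c" for x
    using potential_energy_in_eq[OF c, of x] that
    by (auto simp: nonzero_domain_def potential_energy_in_def)
  have lin: "linear (L_matrix c x)" if "x \<in> nonzero_domain c" for x
    using that by (intro linear_L_matrix[OF c]) (auto simp: nonzero_domain_def)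
  note D = derivative_along_potential[OF z lin vfcomp_dLE_sharp[OF c] dLE_sharp_differentiable[OF c z]]
  show "(potential_energy \<circ> cinv (tchart c)) differentiable (at z)"
    by (rule differentiable_cong_open[OF open_domain z eq, THEN iffD2, OF _ differentiableI[OF D(1)]])
  have "fderiv (potential_energy \<circ> cinv (tchart c)) z
      = fderiv (\<lambda>x. fderiv (energy_in c) x (0, L_matrix c x (snd x))) z"
    by (rule fderiv_cong_open[OF open_domain z eq])
  then show "fderiv (potential_energy \<circ> cinv (tchart c)) z (0, a)
      = fderiv (energy_in c) z (0, L_matrix c z a)
        + fderiv (energy_in c) z (0, snd (fderiv (vfcomp (tchart c) dLE_sharp) z (0, a)))"
    using D(2)[of a] by simp
qed

text \<open>The key identity \<open>d\<^sub>h E = d\<^sub>J (L\<^sup>\<circ>E)\<close> for the \<open>L\<close>-connection \<open>h\<close>. The Berwald connection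
contributes nothing, and since \<open>(d\<^sub>LE)\<^sup># = (0, s)\<close> is vertical its bracket with \<open>J\<close> maps \<open>(a, b)\<close> to
\<open>(0, D\<^sub>ys a)\<close>. What remains is the vertical derivative of \<open>E\<^sub>y(s) = L\<^sup>\<circ>E\<close>.\<close>

lemma d_energy_L_connection:
  assumes v: "v \<in> nonzero_tangent A" and \<xi>: "\<xi> \<in> tangent_space TB v"
  shows "dfun TB E (L_connection A E L \<xi>) = dfun TB potential_energy (vertical_endo A \<xi>)"
proof -
  have vB: "v \<in> tangent_bundle A" by (rule nonzero_in_bundle[OF v])
  (* in the chart chosen by the definition of dfun, the differential of E is read off for every
     vector with base point v *)
  obtain c where c': "chart_at TB v = tchart c" and c: "c \<in> charts_at A (base v)"
    using charts_at_tangent_atlasE[OF T.chart_at_in] vB points_tangent_atlas by blast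
  let ?c = "tchart c" and ?z = "cmap (tchart c) v"
  have cA: "c \<in> A" by (rule charts_atD(1)[OF c])
  interpret coordinate_energy "nonzero_domain c" "energy_in c" by (rule coordinate_energy[OF cA])
  have z: "?z \<in> nonzero_domain c" by (rule coordinates_in_nonzero_domain[OF v c])
  define D where "D = fderiv (vfcomp ?c dLE_sharp) ?z"
  obtain a b where ab: "comp \<xi> ?c = (a, b)" by fastforce
  have lin: "linear (L_matrix c x)" if "x \<in> nonzero_domain c" for x
    using that by (intro linear_L_matrix[OF cA]) (auto simp: nonzero_domain_def)
  have fstD: "fst (D w) = 0" for w
  proof -
    have 1: "((\<lambda>x. 0) has_derivative (\<lambda>w. fst (D w))) (at ?z)"
      unfolding D_def
      by (rule has_derivative_transform_within_open[OF
            has_derivative_fst[OF fderiv_works[OF dLE_sharp_differentiable[OF cA z]]] open_domain z])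
         (rule sharp_semibasic_vertical[OF _ vfcomp_dLE_sharp[OF cA] lin])
    show ?thesis by (rule fun_cong[OF has_derivative_unique[OF 1 has_derivative_const]])
  qed
  have diff: "vfcomp d dLE_sharp differentiable (at (cmap d v))" if "d \<in> charts_at TB v" for d
    using that
  proof (rule charts_at_tangent_atlasE)
    fix c assume "d = tchart c" "c \<in> charts_at A (base v)"
    then show ?thesis
      using dLE_sharp_differentiable[OF charts_atD(1) coordinates_in_nonzero_domain[OF v]] by blast
  qed
  have "comp (vform_bracket TB (vertical_endo A) dLE_sharp \<xi>) ?c = D (0, a) - (0, fst (D (a, b)))"
    using comp_bracket_vertical_endo[OF openin_nonzero v dLE_sharp_in diff \<xi> c]
    by (simp add: D_def[symmetric] ab)
  also have "\<dots> = (0, snd (D (0, a)))" using fstD by (simp add: prod_eq_iff)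
  finally have bracket: "comp (vform_bracket TB (vertical_endo A) dLE_sharp \<xi>) ?c = (0, snd (D (0, a)))" .
  have "base (L_connection A E L \<xi>) = v"
    by (simp add: L_connection_def berwald_connection_def tadd_def tscale_def T.base_eq[OF \<xi>])
  then have "dfun TB E (L_connection A E L \<xi>) = fderiv (energy_in c) ?z (comp (L_connection A E L \<xi>) ?c)"
    by (simp add: dfun_def c' Let_def)
  also have "comp (L_connection A E L \<xi>) ?c
      = comp (berwald_connection A E \<xi>) ?c + (0, L_matrix c ?z a) + (0, snd (D (0, a)))"
    by (simp only: L_connection_def tadd_def tvec.sel comp_L[OF vB \<xi> c] bracket ab fst_conv)
  also have "fderiv (energy_in c) ?z \<dots>
      = fderiv (energy_in c) ?z (0, L_matrix c ?z a) + fderiv (energy_in c) ?z (0, snd (D (0, a)))"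
    unfolding linear_add[OF linear_de[OF z]] berwald_connection_in_chart[OF v \<xi> c] by simp
  also have "\<dots> = fderiv (potential_energy \<circ> cinv ?c) ?z (0, a)"
    unfolding potential_energy_differentiable(2)[OF cA z] D_def ..
  also have "\<dots> = dfun TB potential_energy (vertical_endo A \<xi>)"
    using T.dfun_in_chart[OF vertical_endo_in[OF vB \<xi>] tchart_in[OF vB c]
        potential_energy_differentiable(1)[OF cA z]] comp_vertical_endo[OF vB c \<xi>]
    by (simp add: ab)
  finally show ?thesis .
qed

lemma conservative_iff_vertical_derivative:
  "conservative A E (L_connection A E L) \<longleftrightarrow>
    (\<forall>c\<in>A. \<forall>z\<in>nonzero_domain c. \<forall>a. fderiv (potential_energy \<circ> cinv (tchart c)) z (0, a) = 0)"
    (is "?l \<longleftrightarrow> ?r")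
proof -
  have J: "dfun TB potential_energy (vertical_endo A \<xi>)
      = fderiv (potential_energy \<circ> cinv (tchart c)) (cmap (tchart c) v) (0, fst (comp \<xi> (tchart c)))"
    if "v \<in> nonzero_tangent A" "\<xi> \<in> tangent_space TB v" "c \<in> charts_at A (base v)" for v \<xi> c
    using T.dfun_in_chart[OF vertical_endo_in[OF nonzero_in_bundle that(2)]
        tchart_in[OF nonzero_in_bundle that(3)]
        potential_energy_differentiable(1)[OF charts_atD(1) coordinates_in_nonzero_domain]]
      comp_vertical_endo[OF nonzero_in_bundle that(3,2)] that by simp
  have cons: "?l \<longleftrightarrow> (\<forall>v\<in>nonzero_tangent A. \<forall>\<xi>\<in>tangent_space TB v.
      dfun TB potential_energy (vertical_endo A \<xi>) = 0)"
    unfolding conservative_def d_along_def using d_energy_L_connection by simp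
  show ?thesis
  proof
    assume l: ?l
    show ?r
    proof (intro ballI allI)
      fix c z a assume c: "c \<in> A" and z: "z \<in> nonzero_domain c"
      obtain v where v: "v \<in> nonzero_tangent A" "c \<in> charts_at A (base v)" "z = cmap (tchart c) v"
        using nonzero_domainE[OF c z] by blast
      have cv: "tchart c \<in> charts_at TB v" by (rule tchart_in[OF nonzero_in_bundle[OF v(1)] v(2)])
      show "fderiv (potential_energy \<circ> cinv (tchart c)) z (0, a) = 0"
        using J[OF v(1) T.tangent_vector_in[OF cv] v(2), of "(a, 0)"] l v
          T.tangent_vector_in[OF cv, of "(a, 0)"] T.comp_tangent_vector_self[OF cv, of "(a, 0)"]
        unfolding cons by simp
    qed
  next
    assume r: ?r
    show ?l
      unfolding cons
    proof (intro ballI)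
      fix v \<xi> assume v: "v \<in> nonzero_tangent A" and \<xi>: "\<xi> \<in> tangent_space TB v"
      obtain c where c: "c \<in> charts_at A (base v)"
        using exists_chart[OF nonzero_in_bundle[OF v]] by blast
      show "dfun TB potential_energy (vertical_endo A \<xi>) = 0"
        using J[OF v \<xi> c] r charts_atD(1)[OF c] coordinates_in_nonzero_domain[OF v c] by simp
    qed
  qed
qed

text \<open>A function without vertical derivative off the zero section is constant along each open ray. The
  rays end in the zero section, where \<open>L\<^sup>\<circ>E\<close> vanishes, and \<open>L\<^sup>\<circ>E\<close> is continuous there.\<close>

lemma potential_energy_zero:
  assumes zero: "\<And>c z a. c \<in> A \<Longrightarrow> z \<in> nonzero_domain c \<Longrightarrow>
      fderiv (potential_energy \<circ> cinv (tchart c)) z (0, a) = 0"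
    and v: "v \<in> tangent_bundle A"
  shows "potential_energy v = 0"
proof -
  obtain c where c: "c \<in> charts_at A (base v)" using exists_chart[OF v] by blast
  have cA: "c \<in> A" by (rule charts_atD(1)[OF c])
  let ?U = "(cmap c ` cdom c) \<times> (UNIV :: 'e set)"
  define x y where "x = cmap c (base v)" and "y = comp v c"
  define g where "g r = (potential_energy \<circ> cinv (tchart c)) ((x, 0) + r *\<^sub>R (0, y))" for r
  have inU: "(x, 0) + r *\<^sub>R (0, y) \<in> ?U" for r
    using coordinates_in_image[OF c] by (simp add: x_def cmap_tchart)
  have g: "g r = potential_energy_in c ((x, 0) + r *\<^sub>R (0, y))" for r
    unfolding g_def by (rule potential_energy_in_eq[OF cA inU])
  have "g 0 = 0"
    unfolding g potential_energy_in_def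
    using linear_0[OF linear_L_matrix[OF cA inU[of 0]]]
      linear_0[OF linear_fderiv[OF energy_in_differentiable[OF cA inU[of 0]]]]
    by (simp add: zero_prod_def)
  moreover have "g 1 = g 0"
  proof (cases "y = 0")
    case False
    show ?thesis
    proof (rule DERIV_isconst_end[of 0 1 g])
      show "continuous_on {0..1} g"
        unfolding g
        by (rule continuous_on_compose2[OF continuous_potential_energy_in[OF cA]])
           (use inU in \<open>auto intro!: continuous_intros\<close>)
      fix r :: real assume "0 < r" "r < 1"
      then have "(x, 0) + r *\<^sub>R (0, y) \<in> nonzero_domain c"
        using False inU[of r] by (simp add: nonzero_domain_def)
      then show "DERIV g r :> 0"
        using has_real_derivative_along_line[OF potential_energy_differentiable(1)[OF cA]] zero[OF cA]
        unfolding g_def by metis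
    qed simp
  qed (simp add: g_def)
  moreover have "g 1 = potential_energy v"
    using cinv_coordinates[OF v c] by (simp add: g_def x_def y_def cmap_tchart[of c v])
  ultimately show ?thesis by simp
qed

lemma vertical_derivative_vertical_lift:
  assumes f: "\<And>v. v \<in> tangent_bundle A \<Longrightarrow> potential_energy v = f (base v)"
    and c: "c \<in> A" and z: "z \<in> nonzero_domain c"
  shows "fderiv (potential_energy \<circ> cinv (tchart c)) z (0, a) = 0"
proof -
  have const: "(potential_energy \<circ> cinv (tchart c)) (z + r *\<^sub>R (0, a)) = f (cinv c (fst z))" for r
  proof -
    have "z + r *\<^sub>R (0, a) \<in> (cmap c ` cdom c) \<times> UNIV" using z by (auto simp: nonzero_domain_def)
    then obtain v where v: "v \<in> tangent_bundle A" "c \<in> charts_at A (base v)"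
      "z + r *\<^sub>R (0, a) = cmap (tchart c) v" "cinv (tchart c) (z + r *\<^sub>R (0, a)) = v"
      by (rule bundle_coordinatesE[OF c])
    have "fst z = cmap c (base v)"
      using arg_cong[OF v(3), of fst] by (simp add: cmap_tchart)
    then show ?thesis using f[OF v(1)] v(2,4) by (simp add: charts_at_def cinv_cmap)
  qed
  have z0: "z + 0 *\<^sub>R (0, a) = z"
    by (simp add: zero_prod_def[symmetric])
  have "((\<lambda>r. (potential_energy \<circ> cinv (tchart c)) (z + r *\<^sub>R (0, a))) has_real_derivative
      fderiv (potential_energy \<circ> cinv (tchart c)) z (0, a)) (at 0)"
    using has_real_derivative_along_line[of "potential_energy \<circ> cinv (tchart c)" z 0 "(0, a)"]
      potential_energy_differentiable(1)[OF c z] unfolding z0 by blast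
  then show ?thesis
    unfolding const by (rule DERIV_unique[OF _ DERIV_const])
qed

lemma conservative_iff:
  "conservative A E (L_connection A E L) \<longleftrightarrow>
    is_vertical_lift A (\<lambda>v. dfun (tangent_atlas A) E (potential L S v))"
proof
  assume "conservative A E (L_connection A E L)"
  then have "potential_energy v = 0" if "v \<in> tangent_bundle A" for v
    using potential_energy_zero that unfolding conservative_iff_vertical_derivative by blast
  moreover have "smooth_fun A (points A) (\<lambda>p. 0 :: real)"
    by (simp add: smooth_fun_def Ck_fun_def o_def Ck_on_const)
  ultimately show "is_vertical_lift A (\<lambda>v. dfun (tangent_atlas A) E (potential L S v))"
    unfolding is_vertical_lift_def potential_energy_def by blast
next
  assume "is_vertical_lift A (\<lambda>v. dfun (tangent_atlas A) E (potential L S v))"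
  then show "conservative A E (L_connection A E L)"
    unfolding is_vertical_lift_def conservative_iff_vertical_derivative
    using vertical_derivative_vertical_lift unfolding potential_energy_def by blast
qed

end

theorem theorem1:
  fixes A :: "('a, 'e::euclidean_space) chart set"
    and E :: "('a, 'e) tvec \<Rightarrow> real"
    and L :: "(('a, 'e) tvec, 'e \<times> 'e) vform"
    and S :: "(('a, 'e) tvec, 'e \<times> 'e) vfield"
  assumes "smooth_manifold A"
    and "connected_space (manifold_topology A)"
    and "finsler_energy A E"
    and "smooth_vform (tangent_atlas A) (tangent_bundle A) L"
    and "semibasic A L"
    and "semispray A S"
  shows "conservative A E (L_connection A E L) \<longleftrightarrow>
    is_vertical_lift A (\<lambda>v. dfun (tangent_atlas A) E (potential L S v))"
proof -
  interpret finsler_semibasic A E L S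
    using assms by unfold_locales (simp_all add: smooth_manifold_def)
  show ?thesis by (rule conservative_iff)
qed

end
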